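(* Let $\mathscr{L}_M$ be the real affine variety of locally maximally mixed states of two qubits, with the action of $U_2\times U_2$ by local unitary conjugation. Then there is an isomorphism of graded $\mathbb{R}$-algebras $$\mathbb{R}[\mathscr{L}_M]^{U_2\times U_2}\;\cong\;\mathbb{R}[t_2,t_3,t_4],$$ where the right-hand side is a polynomial ring and $t_i$ is of degree $i$. The field $\mathbb{R}(\mathscr{L}_M)^{U_2\times U_2}$ is the fraction field of $\mathbb{R}[\mathscr{L}_M]^{U_2\times U_2}$; it is therefore purely transcendental over $\mathbb{R}$ of (transcendence) degree $3$, generated by $t_2,t_3,t_4$.
   Context: Let $V_1=V_2=\mathbb{C}^2$ with the standard Hermitian inner product, $V=V_1\otimes V_2$, and let $U_2$ be the group of complex unitary $2\times 2$ matrices. The Liouville space $\mathscr{L}$ is the real affine space of Hermitian operators $\rho$ on $V$ with $\operatorname{Tr}(\rho)=1$. The group $U_2\times U_2$ acts on $\mathscr{L}$ by $(U_1,U_2)\cdot\rho=(U_1\otimes U_2)\,\rho\,(U_1\otimes U_2)^{*}$. Let $\operatorname{tr}_1,\operatorname{tr}_2$ denote the partial traces over $V_1$, $V_2$ respectively (e.g. $\operatorname{tr}_2(a\otimes b)=\operatorname{Tr}(b)\,a$ for $a\in\operatorname{End}(V_1)$, $b\in\operatorname{End}(V_2)$, extended linearly; $\operatorname{tr}_1$ is analogous). The variety of locally maximally mixed states is $$\mathscr{L}_M=\{\rho\in\mathscr{L}:\operatorname{tr}_1(\rho)=\tfrac12 I=\operatorname{tr}_2(\rho)\},$$ a $U_2\times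 U_2$-invariant real affine subspace of $\mathscr{L}$ of dimension $9$. Let $\sigma_1=\begin{pmatrix}0&1\\1&0\end{pmatrix}$, $\sigma_2=\begin{pmatrix}0&-i\\i&0\end{pmatrix}$, $\sigma_3=\begin{pmatrix}1&0\\0&-1\end{pmatrix}$ be the Pauli matrices. The functions $C_{ij}(\rho)=\operatorname{Tr}(\rho\cdot\sigma_i\otimes\sigma_j)$, $1\le i,j\le 3$, give an isomorphism of $\mathscr{L}_M$ with the real vector space of $3\times 3$ real matrices $C=(C_{ij})$, under which the action becomes linear. $\mathbb{R}[\mathscr{L}_M]$ is the ring of real-valued polynomial functions on $\mathscr{L}_M$, i.e. $\mathbb{R}[C_{ij}:1\le i,j\le3]$, graded by polynomial degree in the $C_{ij}$, and $\mathbb{R}(\mathscr{L}_M)$ is its fraction field. The superscript $U_2\times U_2$ denotes the subring (resp. subfield) of elements $f$ with $f(gx)=f(x)$ for all $g\in U_2\times U_2$. *)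

theory Defs
  imports
    "HOL-Analysis.Analysis"
    "HOL-Library.Poly_Mapping"
    "HOL-Computational_Algebra.Fraction_Field"
    "HOL-Computational_Algebra.Polynomial"
begin

section \<open>Locally maximally mixed states of two qubits\<close>

type_synonym op2 = "complex^2^2"
type_synonym op4 = "complex^(2 \<times> 2)^(2 \<times> 2)"

definition adj :: "complex^'n^'m \<Rightarrow> complex^'m^'n" where
  "adj A = (\<chi> i j. cnj (A $ j $ i))"

definition hermitian :: "complex^'n^'n \<Rightarrow> bool" where
  "hermitian A \<longleftrightarrow> adj A = A"

definition unitary_group :: "(complex^'n^'n) set" where
  "unitary_group = {A. A ** adj A = mat 1 \<and> adj A ** A = mat 1}"

text \<open>The standard basis vector of \<open>V\<^sub>1 \<otimes> V\<^sub>2\<close> with index \<open>(i, k)\<close> is \<open>e\<^sub>i \<otimes> e\<^sub>k\<close>.\<close>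

definition tensor_op :: "op2 \<Rightarrow> op2 \<Rightarrow> op4" where
  "tensor_op a b = (\<chi> r s. a $ fst r $ fst s * b $ snd r $ snd s)"

definition ptrace1 :: "op4 \<Rightarrow> op2" where
  "ptrace1 \<rho> = (\<chi> k l. \<Sum>i\<in>UNIV. \<rho> $ (i, k) $ (i, l))"

definition ptrace2 :: "op4 \<Rightarrow> op2" where
  "ptrace2 \<rho> = (\<chi> i j. \<Sum>k\<in>UNIV. \<rho> $ (i, k) $ (j, k))"

lemma ptrace1_tensor_op: "ptrace1 (tensor_op a b) = (\<chi> k l. trace a * b $ k $ l)"
  by (simp add: ptrace1_def tensor_op_def trace_def sum_distrib_right)

lemma ptrace2_tensor_op: "ptrace2 (tensor_op a b) = (\<chi> i j. a $ i $ j * trace b)"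
  by (simp add: ptrace2_def tensor_op_def trace_def sum_distrib_left)

definition liouville :: "op4 set" where
  "liouville = {\<rho>. hermitian \<rho> \<and> trace \<rho> = 1}"

definition lmm :: "op4 set" where
  "lmm = {\<rho> \<in> liouville. ptrace1 \<rho> = mat (1/2) \<and> ptrace2 \<rho> = mat (1/2)}"

definition act :: "op2 \<Rightarrow> op2 \<Rightarrow> op4 \<Rightarrow> op4" where
  "act U W \<rho> = tensor_op U W ** \<rho> ** adj (tensor_op U W)"

text \<open>In the type \<open>3\<close> the numeral \<open>3\<close> denotes the same element as \<open>0\<close>.\<close>

definition pauli :: "3 \<Rightarrow> op2" where
  "pauli i =
    (if i = 1 then vector [vector [0, 1], vector [1, 0]]
     else if i = 2 then vector [vector [0, - \<i>], vector [\<i>, 0]]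
     else vector [vector [1, 0], vector [0, - 1]])"

text \<open>The trace below is real whenever \<open>\<rho>\<close> is Hermitian, so \<open>Re\<close> only changes the type.\<close>

definition corr :: "3 \<Rightarrow> 3 \<Rightarrow> op4 \<Rightarrow> real" where
  "corr i j \<rho> = Re (trace (\<rho> ** tensor_op (pauli i) (pauli j)))"


section \<open>Polynomials with real coefficients\<close>

type_synonym 'v rpoly = "('v \<Rightarrow>\<^sub>0 nat) \<Rightarrow>\<^sub>0 real"

definition pconst :: "real \<Rightarrow> 'v rpoly" where
  "pconst c = Poly_Mapping.single 0 c"

definition pvar :: "'v \<Rightarrow> 'v rpoly" where
  "pvar v = Poly_Mapping.single (Poly_Mapping.single v 1) 1"

definition pvars :: "'v rpoly \<Rightarrow> 'v set" where
  "pvars p = (\<Union>m\<in>Poly_Mapping.keys p. Poly_Mapping.keys m)"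

text \<open>Evaluation at the point \<open>x\<close> of a commutative ring, with \<open>\<iota>\<close> the structure map
  from the real numbers.\<close>

definition peval :: "(real \<Rightarrow> 'k) \<Rightarrow> ('v \<Rightarrow> 'k) \<Rightarrow> 'v rpoly \<Rightarrow> 'k::comm_ring_1" where
  "peval \<iota> x p =
    (\<Sum>m\<in>Poly_Mapping.keys p. \<iota> (Poly_Mapping.lookup p m) *
      (\<Prod>v\<in>Poly_Mapping.keys m. x v ^ Poly_Mapping.lookup m v))"

definition homogeneous :: "('v \<Rightarrow> nat) \<Rightarrow> nat \<Rightarrow> 'v rpoly \<Rightarrow> bool" where
  "homogeneous w d p \<longleftrightarrow>
    (\<forall>m\<in>Poly_Mapping.keys p. (\<Sum>v\<in>Poly_Mapping.keys m. w v * Poly_Mapping.lookup m v) = d)"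

text \<open>\<open>\<phi>\<close> is an isomorphism of graded \<open>\<real>\<close>-algebras from the polynomial ring graded by the
  weights \<open>w\<close> onto the subalgebra \<open>A\<close> of the polynomial ring graded by the weights \<open>w'\<close>.\<close>

definition graded_algebra_iso ::
  "('v \<Rightarrow> nat) \<Rightarrow> ('u \<Rightarrow> nat) \<Rightarrow> 'u rpoly set \<Rightarrow> ('v rpoly \<Rightarrow> 'u rpoly) \<Rightarrow> bool" where
  "graded_algebra_iso w w' A \<phi> \<longleftrightarrow>
    (\<forall>p q. \<phi> (p + q) = \<phi> p + \<phi> q) \<and>
    (\<forall>p q. \<phi> (p * q) = \<phi> p * \<phi> q) \<and>
    (\<forall>c. \<phi> (pconst c) = pconst c) \<and>
    bij_betw \<phi> UNIV A \<and>
    (\<forall>d. \<phi> ` {p. homogeneous w d p} = {f \<in> A. homogeneous w' d f})"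


section \<open>Subfields of a rational function field\<close>

type_synonym 'v rrat = "'v rpoly fract"

definition rconst :: "real \<Rightarrow> 'v::linorder rrat" where
  "rconst c = Fract (pconst c) 1"

definition is_subfield :: "'k::field set \<Rightarrow> bool" where
  "is_subfield F \<longleftrightarrow> 0 \<in> F \<and> 1 \<in> F \<and>
    (\<forall>a\<in>F. \<forall>b\<in>F. a + b \<in> F \<and> a * b \<in> F) \<and> (\<forall>a\<in>F. - a \<in> F \<and> inverse a \<in> F)"

definition generated_field :: "'v::linorder rrat set \<Rightarrow> 'v rrat set" where
  "generated_field S = \<Inter>{F. is_subfield F \<and> range rconst \<subseteq> F \<and> S \<subseteq> F}"

text \<open>The fraction field of a subring \<open>A\<close> of the polynomial ring, formed inside the field of
  all rational functions.\<close>

definition fraction_field :: "'v::linorder rpoly set \<Rightarrow> 'v rrat set" where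
  "fraction_field A = {Fract p q | p q. p \<in> A \<and> q \<in> A \<and> q \<noteq> 0}"

text \<open>The elements of \<open>B\<close> themselves serve as names of the indeterminates.\<close>

definition algebraically_independent :: "'v::linorder rrat set \<Rightarrow> bool" where
  "algebraically_independent B \<longleftrightarrow>
    (\<forall>P :: 'v rrat rpoly. pvars P \<subseteq> B \<longrightarrow> peval rconst (\<lambda>b. b) P = 0 \<longrightarrow> P = 0)"

definition algebraic_over :: "'k::field set \<Rightarrow> 'k \<Rightarrow> bool" where
  "algebraic_over F a \<longleftrightarrow> (\<exists>p :: 'k poly. p \<noteq> 0 \<and> (\<forall>i. coeff p i \<in> F) \<and> poly p a = 0)"

definition transcendence_basis :: "'v::linorder rrat set \<Rightarrow> 'v rrat set \<Rightarrow> bool" where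
  "transcendence_basis K B \<longleftrightarrow> B \<subseteq> K \<and> algebraically_independent B \<and>
    (\<forall>a\<in>K. algebraic_over (generated_field B) a)"

text \<open>All transcendence bases of a field extension have the same cardinality.\<close>

definition has_transcendence_degree :: "'v::linorder rrat set \<Rightarrow> nat \<Rightarrow> bool" where
  "has_transcendence_degree K n \<longleftrightarrow> (\<exists>B. transcendence_basis K B \<and> finite B \<and> card B = n)"

text \<open>\<open>K\<close> is purely transcendental over \<open>\<real>\<close>, with the elements of \<open>B\<close> as independent
  generators.\<close>

definition purely_transcendental :: "'v::linorder rrat set \<Rightarrow> 'v rrat set \<Rightarrow> bool" where
  "purely_transcendental K B \<longleftrightarrow> algebraically_independent B \<and> K = generated_field B"


section \<open>Polynomial and rational functions on locally maximally mixed states\<close>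

text \<open>\<open>Corr i j\<close> is the indeterminate for the coordinate \<open>corr i j\<close>. Its linear order has no
  mathematical content: the library requires one in order to recognise polynomials as an
  integral domain.\<close>

datatype coord = Corr (row: 3) (col: 3)

instantiation coord :: linorder
begin

definition less_eq_coord :: "coord \<Rightarrow> coord \<Rightarrow> bool" where
  "less_eq_coord a b \<longleftrightarrow> row a < row b \<or> row a = row b \<and> col a \<le> col b"

definition less_coord :: "coord \<Rightarrow> coord \<Rightarrow> bool" where
  "less_coord a b \<longleftrightarrow> row a < row b \<or> row a = row b \<and> col a < col b"

instance
  by standard (auto simp: less_eq_coord_def less_coord_def coord.expand)

end

text \<open>Since the coordinates \<open>corr i j\<close> identify \<open>lmm\<close> with the space of real \<open>3 \<times> 3\<close> matrices,
  polynomials in the indeterminates \<open>Corr i j\<close> are the polynomial functions on \<open>lmm\<close>,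
  by means of the following evaluation.\<close>

definition value_at :: "coord rpoly \<Rightarrow> op4 \<Rightarrow> real" where
  "value_at p \<rho> = peval (\<lambda>c. c) (\<lambda>v. corr (row v) (col v) \<rho>) p"

text \<open>The rational function \<open>f\<close> is defined at \<open>\<rho>\<close> and has the value \<open>c\<close> there.\<close>

definition rat_value_at :: "coord rrat \<Rightarrow> op4 \<Rightarrow> real \<Rightarrow> bool" where
  "rat_value_at f \<rho> c \<longleftrightarrow>
    (\<exists>p q. f = Fract p q \<and> value_at q \<rho> \<noteq> 0 \<and> c = value_at p \<rho> / value_at q \<rho>)"

definition invariant_ring :: "coord rpoly set" where
  "invariant_ring = {f. \<forall>U\<in>unitary_group. \<forall>W\<in>unitary_group. \<forall>\<rho>\<in>lmm.
     value_at f (act U W \<rho>) = value_at f \<rho>}"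

text \<open>Invariance of a rational function is tested wherever both sides are defined.\<close>

definition invariant_field :: "coord rrat set" where
  "invariant_field = {f. \<forall>U\<in>unitary_group. \<forall>W\<in>unitary_group. \<forall>\<rho>\<in>lmm. \<forall>c d.
     rat_value_at f (act U W \<rho>) c \<longrightarrow> rat_value_at f \<rho> d \<longrightarrow> c = d}"

datatype gen = t2 | t3 | t4

fun gen_degree :: "gen \<Rightarrow> nat" where
  "gen_degree t2 = 2"
| "gen_degree t3 = 3"
| "gen_degree t4 = 4"

end

theory Submission
  imports
    Defs
    "HOL-Computational_Algebra.Fundamental_Theorem_Algebra"
begin

text \<open>Conjugation by \<open>U\<close> rotates the Pauli matrices, so \<open>(U, W)\<close> acts on the correlation matrix
  by \<open>C \<mapsto> R C S\<^sup>T\<close> with \<open>R, S\<close> in \<open>SO(3)\<close>. The invariants are \<open>tr (C C\<^sup>T)\<close>, \<open>det C\<close> and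
  \<open>tr ((C C\<^sup>T)\<^sup>2)\<close>. By the singular value decomposition every orbit contains a diagonal matrix
  \<open>diag(a, b, c)\<close>, so an invariant polynomial is determined by its restriction to diagonal
  matrices, which is invariant under permutations and even sign changes of \<open>a, b, c\<close>. Summing
  monomials over this finite group and expressing the result by power sums shows that such a
  restriction is a polynomial in \<open>a\<^sup>2 + b\<^sup>2 + c\<^sup>2\<close>, \<open>a b c\<close> and \<open>a\<^sup>4 + b\<^sup>4 + c\<^sup>4\<close>.
  These three are algebraically independent because over the complex numbers they take all
  triples of values.\<close>


section \<open>Evaluation of polynomials\<close>

text \<open>The order 24 of the finite group is the product 2 * 3 * 4 of the degrees of the
  invariants, as Chevalley's theorem predicts for a reflection group. Averaging over this group in
  place of the compact group keeps the argument algebraic: the average is taken on diagonal matrices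
  only, and its polynomial expression is then compared with the given invariant on all orbits.
  Independence passes through complex matrices because real ones satisfy inequalities such as
  \<open>t2\<close> \<ge> 0. Two obstacles shape the part on rational functions. A denominator may
  vanish on all diagonal matrices, so the diagonal slice is first moved by two rotations. And a
  fraction has many representatives, each defined at other points, so invariance has to be carried
  by polynomial identities from which a nonzero factor is cancelled before any point is
  inserted.\<close>

definition ring_hom_map :: "('a::comm_ring_1 \<Rightarrow> 'b::comm_ring_1) \<Rightarrow> bool" where
  "ring_hom_map h \<longleftrightarrow> h 1 = 1 \<and> (\<forall>a b. h (a + b) = h a + h b) \<and> (\<forall>a b. h (a * b) = h a * h b)"

lemma ring_hom_mapI:
  assumes "h 1 = 1" "\<And>a b. h (a + b) = h a + h b" "\<And>a b. h (a * b) = h a * h b"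
  shows "ring_hom_map h"
  using assms by (simp add: ring_hom_map_def)

context
  fixes h :: "'a::comm_ring_1 \<Rightarrow> 'b::comm_ring_1"
  assumes h: "ring_hom_map h"
begin

lemma hom_one: "h 1 = 1"
  and hom_add: "h (a + b) = h a + h b"
  and hom_mult: "h (a * b) = h a * h b"
  using h by (auto simp: ring_hom_map_def)

lemma hom_zero: "h 0 = 0"
  using hom_add[of 0 0] by simp

lemma hom_uminus: "h (- a) = - h a"
  using hom_add[of a "- a"] hom_zero by (simp add: eq_neg_iff_add_eq_0 add.commute)

lemma hom_diff: "h (a - b) = h a - h b"
  using hom_add[of a "- b"] hom_uminus[of b] by simp

lemma hom_power: "h (a ^ n) = h a ^ n"
  by (induction n) (simp_all add: hom_one hom_mult)

lemma hom_sum: "h (sum f A) = (\<Sum>x\<in>A. h (f x))"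
  by (induction A rule: infinite_finite_induct) (simp_all add: hom_zero hom_add)

lemma hom_prod: "h (prod f A) = (\<Prod>x\<in>A. h (f x))"
  by (induction A rule: infinite_finite_induct) (simp_all add: hom_one hom_mult)

lemmas hom_simps = hom_zero hom_one hom_add hom_mult hom_uminus hom_diff hom_power hom_sum hom_prod

end

lemma ring_hom_map_comp: "ring_hom_map g \<Longrightarrow> ring_hom_map h \<Longrightarrow> ring_hom_map (\<lambda>x. g (h x))"
  by (simp add: ring_hom_map_def)

lemma ring_hom_map_id: "ring_hom_map (\<lambda>x. x)"
  by (simp add: ring_hom_map_def)

lemma ring_hom_map_of_real: "ring_hom_map complex_of_real"
  by (simp add: ring_hom_map_def)

lemma ring_hom_map_pconst: "ring_hom_map (pconst :: real \<Rightarrow> 'v rpoly)"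
  by (simp add: ring_hom_map_def pconst_def single_add mult_single)

lemma ring_hom_map_Fract: "ring_hom_map (\<lambda>p :: 'v::linorder rpoly. Fract p 1)"
  by (simp add: ring_hom_map_def One_fract_def)

lemma ring_hom_map_rconst: "ring_hom_map (rconst :: real \<Rightarrow> 'v::linorder rrat)"
  using ring_hom_map_comp[OF ring_hom_map_Fract ring_hom_map_pconst]
  by (simp add: rconst_def[abs_def])


section \<open>Values of monomials and polynomials\<close>

definition meval :: "('v \<Rightarrow> 'k) \<Rightarrow> ('v \<Rightarrow>\<^sub>0 nat) \<Rightarrow> 'k::comm_ring_1" where
  "meval x m = (\<Prod>v\<in>Poly_Mapping.keys m. x v ^ Poly_Mapping.lookup m v)"

lemma meval_superset:
  assumes "finite A" "Poly_Mapping.keys m \<subseteq> A"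
  shows "meval x m = (\<Prod>v\<in>A. x v ^ Poly_Mapping.lookup m v)"
  unfolding meval_def using assms
  by (intro prod.mono_neutral_left) (auto simp: in_keys_iff)

lemma meval_zero: "meval x 0 = 1"
  by (simp add: meval_def)

lemma meval_add: "meval x (m + n) = meval x m * meval x n"
proof -
  let ?A = "Poly_Mapping.keys m \<union> Poly_Mapping.keys n"
  have "meval x (m + n) = (\<Prod>v\<in>?A. x v ^ Poly_Mapping.lookup (m + n) v)"
    by (intro meval_superset) (auto dest: subsetD[OF Poly_Mapping.keys_add])
  also have "\<dots> = (\<Prod>v\<in>?A. x v ^ Poly_Mapping.lookup m v) * (\<Prod>v\<in>?A. x v ^ Poly_Mapping.lookup n v)"
    by (simp add: lookup_add power_add prod.distrib)
  also have "\<dots> = meval x m * meval x n"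
    by (simp add: meval_superset[where A = ?A and m = m] meval_superset[where A = ?A and m = n])
  finally show ?thesis .
qed

lemma meval_mult: "meval (\<lambda>v. x v * y v) m = meval x m * meval y m"
  by (simp add: meval_def power_mult_distrib prod.distrib)

lemma peval_meval: "peval \<iota> x p = (\<Sum>m\<in>Poly_Mapping.keys p. \<iota> (Poly_Mapping.lookup p m) * meval x m)"
  by (simp add: peval_def meval_def)

lemma poly_mapping_sum_singles:
  "p = (\<Sum>m\<in>Poly_Mapping.keys p. Poly_Mapping.single m (Poly_Mapping.lookup p m))"
  by (rule poly_mapping_eqI) (simp add: lookup_sum lookup_single when_def in_keys_iff)

context
  fixes \<iota> :: "real \<Rightarrow> 'k::comm_ring_1" and x :: "'v \<Rightarrow> 'k"
  assumes \<iota>: "ring_hom_map \<iota>"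
begin

lemma peval_superset:
  assumes "finite A" "Poly_Mapping.keys p \<subseteq> A"
  shows "peval \<iota> x p = (\<Sum>m\<in>A. \<iota> (Poly_Mapping.lookup p m) * meval x m)"
  unfolding peval_meval using assms
  by (intro sum.mono_neutral_left) (auto simp: in_keys_iff hom_zero[OF \<iota>])

lemma peval_add: "peval \<iota> x (p + q) = peval \<iota> x p + peval \<iota> x q"
proof -
  let ?A = "Poly_Mapping.keys p \<union> Poly_Mapping.keys q"
  have "peval \<iota> x (p + q) = (\<Sum>m\<in>?A. \<iota> (Poly_Mapping.lookup (p + q) m) * meval x m)"
    by (intro peval_superset) (auto dest: subsetD[OF Poly_Mapping.keys_add])
  also have "\<dots> = (\<Sum>m\<in>?A. \<iota> (Poly_Mapping.lookup p m) * meval x m)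
      + (\<Sum>m\<in>?A. \<iota> (Poly_Mapping.lookup q m) * meval x m)"
    by (simp add: lookup_add hom_add[OF \<iota>] distrib_right sum.distrib)
  also have "\<dots> = peval \<iota> x p + peval \<iota> x q"
    by (simp add: peval_superset[where A = ?A and p = p] peval_superset[where A = ?A and p = q])
  finally show ?thesis .
qed

lemma peval_single: "peval \<iota> x (Poly_Mapping.single m c) = \<iota> c * meval x m"
  by (simp add: peval_meval hom_zero[OF \<iota>])

lemma peval_sum: "peval \<iota> x (sum f A) = (\<Sum>a\<in>A. peval \<iota> x (f a))"
  by (induction A rule: infinite_finite_induct) (simp_all add: peval_add, simp_all add: peval_def)

lemma peval_mult: "peval \<iota> x (p * q) = peval \<iota> x p * peval \<iota> x q"
proof -
  have "p * q = (\<Sum>m\<in>Poly_Mapping.keys p. Poly_Mapping.single m (Poly_Mapping.lookup p m))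
      * (\<Sum>n\<in>Poly_Mapping.keys q. Poly_Mapping.single n (Poly_Mapping.lookup q n))"
    by (rule arg_cong2[where f = "(*)", OF poly_mapping_sum_singles poly_mapping_sum_singles])
  also have "\<dots> = (\<Sum>m\<in>Poly_Mapping.keys p. \<Sum>n\<in>Poly_Mapping.keys q.
      Poly_Mapping.single (m + n) (Poly_Mapping.lookup p m * Poly_Mapping.lookup q n))"
    by (simp only: sum_product mult_single)
  finally have pq: "p * q = \<dots>" .
  have "peval \<iota> x (p * q) = (\<Sum>m\<in>Poly_Mapping.keys p. \<Sum>n\<in>Poly_Mapping.keys q.
      \<iota> (Poly_Mapping.lookup p m) * \<iota> (Poly_Mapping.lookup q n) * (meval x m * meval x n))"
    unfolding pq by (simp only: peval_sum peval_single hom_mult[OF \<iota>] meval_add)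
  also have "\<dots> = peval \<iota> x p * peval \<iota> x q"
    unfolding peval_meval sum_product by (intro sum.cong refl) (simp only: ac_simps)
  finally show ?thesis .
qed

lemma peval_pconst: "peval \<iota> x (pconst c) = \<iota> c"
  by (simp add: pconst_def peval_single meval_zero)

lemma peval_pvar: "peval \<iota> x (pvar v) = x v"
  by (simp add: pvar_def peval_single meval_def hom_one[OF \<iota>])

lemma ring_hom_map_peval: "ring_hom_map (peval \<iota> x)"
proof (rule ring_hom_mapI)
  show "peval \<iota> x 1 = 1"
    using peval_pconst[of 1] by (simp add: pconst_def hom_one[OF \<iota>])
qed (simp_all add: peval_add peval_mult)

end

lemmas peval_simps = hom_simps[OF ring_hom_map_peval] peval_pconst peval_pvar

lemma hom_peval:
  assumes "ring_hom_map h"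
  shows "h (peval \<iota> x p) = peval (\<lambda>c. h (\<iota> c)) (\<lambda>v. h (x v)) p"
  by (simp add: peval_def hom_simps[OF assms])

text \<open>\<open>peval pconst y\<close> is substitution of the polynomials \<open>y v\<close> for
  the indeterminates, so maps such as \<open>inv_map\<close> and \<open>translate\<close> are
  instances of \<open>peval\<close>, and this composition rule computes their values.\<close>

lemma peval_peval:
  assumes "ring_hom_map \<iota>"
  shows "peval \<iota> x (peval pconst y p) = peval \<iota> (\<lambda>v. peval \<iota> x (y v)) p"
  by (subst hom_peval[OF ring_hom_map_peval[OF assms]]) (simp add: peval_pconst[OF assms])

lemma peval_cong_pvars:
  assumes "\<And>v. v \<in> pvars p \<Longrightarrow> x v = y v"
  shows "peval \<iota> x p = peval \<iota> y p"
proof -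
  have "x v = y v" if "m \<in> Poly_Mapping.keys p" "v \<in> Poly_Mapping.keys m" for m v
    using assms that by (auto simp: pvars_def)
  then show ?thesis
    by (simp add: peval_def)
qed

text \<open>Dedekind's argument for the linear independence of characters: with a point \<open>y\<close> that
  separates two monomials, \<open>f (x * y) - meval y m * f x\<close> has fewer terms than \<open>f\<close>.\<close>

lemma monomials_linearly_independent:
  fixes c :: "('v \<Rightarrow>\<^sub>0 nat) \<Rightarrow> real"
  assumes "finite M" "\<And>x :: 'v \<Rightarrow> real. (\<Sum>m\<in>M. c m * meval x m) = 0" "m \<in> M"
  shows "c m = 0"
  using assms
proof (induction "card M" arbitrary: M c m rule: less_induct)
  case less
  have step: "c k = 0" if "k \<in> M" "k \<noteq> l" "l \<in> M" for k l
  proof -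
    obtain v where v: "Poly_Mapping.lookup k v \<noteq> Poly_Mapping.lookup l v"
      using \<open>k \<noteq> l\<close> by (metis poly_mapping_eqI)
    \<comment> \<open>A variable with different exponents in \<open>k\<close> and \<open>l\<close>
      receives the value 2, all others 1; powers of 2 then tell the two monomials apart.\<close>
    define y :: "'v \<Rightarrow> real" where "y = (\<lambda>u. if u = v then 2 else 1)"
    have y: "meval y n = 2 ^ Poly_Mapping.lookup n v" for n
    proof -
      have "meval y n = (\<Prod>u\<in>insert v (Poly_Mapping.keys n). y u ^ Poly_Mapping.lookup n u)"
        by (rule meval_superset) auto
      also have "\<dots> = y v ^ Poly_Mapping.lookup n v
          * (\<Prod>u\<in>Poly_Mapping.keys n - {v}. y u ^ Poly_Mapping.lookup n u)"
        by (simp add: prod.insert_remove)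
      also have "(\<Prod>u\<in>Poly_Mapping.keys n - {v}. y u ^ Poly_Mapping.lookup n u) = 1"
        by (rule prod.neutral) (simp add: y_def)
      finally show ?thesis
        by (simp add: y_def)
    qed
    have "(\<Sum>m\<in>M - {l}. (c m * (meval y m - meval y l)) * meval x m) = 0" for x
    proof -
      have "(\<Sum>m\<in>M. c m * (meval y m - meval y l) * meval x m)
          = (\<Sum>m\<in>M. c m * meval (\<lambda>u. x u * y u) m) - meval y l * (\<Sum>m\<in>M. c m * meval x m)"
        by (simp add: meval_mult sum_distrib_left sum_subtractf algebra_simps)
      also have "\<dots> = 0"
        by (simp only: less.prems(2))
      finally show ?thesis
        using less.prems(1) \<open>l \<in> M\<close> by (simp add: sum.remove)
    qed
    then have "c k * (meval y k - meval y l) = 0"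
    proof (rule less.hyps[of "M - {l}" "\<lambda>m. c m * (meval y m - meval y l)", rotated 2])
      show "card (M - {l}) < card M"
        using less.prems(1) that by (intro card_Diff1_less)
    qed (use less.prems(1) that in auto)
    then show ?thesis
      using v by (simp add: y)
  qed
  show ?case
  proof (cases "M = {m}")
    case True
    then show ?thesis
      using less.prems(2)[of "\<lambda>_. 1"] by (simp add: meval_def)
  next
    case False
    then show ?thesis
      using step[of m] less.prems(3) by (metis insertE insert_iff subsetI subset_antisym empty_iff)
  qed
qed

text \<open>Monomials are linearly independent as functions on real points, so each coefficient
  vanishes. Identities of polynomials can therefore be checked pointwise.\<close>

lemma peval_zero_imp_zero:
  fixes p :: "'v rpoly"
  assumes "\<And>x :: 'v \<Rightarrow> real. peval (\<lambda>c. c) x p = 0"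
  shows "p = 0"
proof (rule poly_mapping_eqI)
  fix m
  show "Poly_Mapping.lookup p m = Poly_Mapping.lookup 0 m"
    using monomials_linearly_independent[of "Poly_Mapping.keys p" "Poly_Mapping.lookup p" m] assms
    by (cases "m \<in> Poly_Mapping.keys p") (auto simp: peval_meval in_keys_iff)
qed

lemma peval_eq_imp_eq:
  fixes p q :: "'v rpoly"
  assumes "\<And>x :: 'v \<Rightarrow> real. peval (\<lambda>c. c) x p = peval (\<lambda>c. c) x q"
  shows "p = q"
proof -
  have "p - q = 0"
    using assms by (intro peval_zero_imp_zero) (simp add: hom_diff[OF ring_hom_map_peval[OF ring_hom_map_id]])
  then show ?thesis
    by simp
qed

text \<open>The substitution multiplies a monomial of weight k by 2 ^ k, which determines k, so the
  single scalar 2 detects the degree. Homogeneity becomes a statement about values, which can be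
  transported along \<open>inv_map\<close>.\<close>

lemma homogeneous_iff_scaling:
  fixes p :: "'v rpoly"
  shows "homogeneous w d p \<longleftrightarrow>
    (\<forall>x. peval (\<lambda>c. c) (\<lambda>v. 2 ^ w v * x v) p = 2 ^ d * peval (\<lambda>c. c) x p)"
proof -
  define wt where "wt m = (\<Sum>v\<in>Poly_Mapping.keys m. w v * Poly_Mapping.lookup m v)" for m :: "'v \<Rightarrow>\<^sub>0 nat"
  have scale: "meval (\<lambda>v. 2 ^ w v * x v) m = 2 ^ wt m * meval x m" for x :: "'v \<Rightarrow> real" and m
  proof -
    have "meval (\<lambda>v. 2 ^ w v) m = (2 :: real) ^ wt m"
      unfolding meval_def wt_def power_sum by (simp only: power_mult)
    then show ?thesis
      by (simp only: meval_mult)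
  qed
  have diff: "peval (\<lambda>c. c) (\<lambda>v. 2 ^ w v * x v) p - 2 ^ d * peval (\<lambda>c. c) x p
      = (\<Sum>m\<in>Poly_Mapping.keys p. (Poly_Mapping.lookup p m * (2 ^ wt m - 2 ^ d)) * meval x m)" for x
    unfolding peval_meval scale sum_distrib_left sum_subtractf[symmetric]
    by (intro sum.cong refl) (simp add: algebra_simps)
  show ?thesis
  proof
    assume "homogeneous w d p"
    then have "peval (\<lambda>c. c) (\<lambda>v. 2 ^ w v * x v) p - 2 ^ d * peval (\<lambda>c. c) x p = 0" for x
      unfolding diff by (intro sum.neutral) (simp add: homogeneous_def wt_def)
    then show "\<forall>x. peval (\<lambda>c. c) (\<lambda>v. 2 ^ w v * x v) p = 2 ^ d * peval (\<lambda>c. c) x p"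
      by simp
  next
    assume *: "\<forall>x. peval (\<lambda>c. c) (\<lambda>v. 2 ^ w v * x v) p = 2 ^ d * peval (\<lambda>c. c) x p"
    have "wt m = d" if "m \<in> Poly_Mapping.keys p" for m
    proof -
      have "Poly_Mapping.lookup p m * (2 ^ wt m - 2 ^ d) = 0"
        using monomials_linearly_independent[of "Poly_Mapping.keys p"
            "\<lambda>m. Poly_Mapping.lookup p m * (2 ^ wt m - 2 ^ d)" m] * that
        by (simp flip: diff)
      then show ?thesis
        using that by (simp add: in_keys_iff)
    qed
    then show "homogeneous w d p"
      by (simp add: homogeneous_def wt_def)
  qed
qed


section \<open>Local unitaries act by rotations\<close>

text \<open>Row i holds the Pauli coordinates of the conjugate of \<open>pauli i\<close>; the 2 is
  the trace of the square of a Pauli matrix. With \<open>adj U\<close> on the left and coordinates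
  in rows, products of unitaries go to products in the same order.\<close>

definition rot_of :: "op2 \<Rightarrow> real^3^3" where
  "rot_of U = (\<chi> i j. Re (trace (pauli j ** (adj U ** pauli i ** U))) / 2)"

lemma pauli_simps:
  "pauli 1 = vector [vector [0, 1], vector [1, 0]]"
  "pauli 2 = vector [vector [0, - \<i>], vector [\<i>, 0]]"
  "pauli 3 = vector [vector [1, 0], vector [0, - 1]]"
  by (simp_all add: pauli_def)

lemma adj_mult: "adj (A ** B) = adj B ** adj A"
  by (simp add: adj_def matrix_matrix_mult_def vec_eq_iff mult.commute)

lemma adj_adj: "adj (adj A) = A"
  by (simp add: adj_def vec_eq_iff)

lemma unitary_group_iff: "U \<in> unitary_group \<longleftrightarrow> U ** adj U = mat 1 \<and> adj U ** U = mat 1"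
  by (simp add: unitary_group_def)

lemma unitary_group_mult:
  assumes "U \<in> unitary_group" "W \<in> unitary_group"
  shows "U ** W \<in> unitary_group"
  using assms unfolding unitary_group_iff adj_mult
  by (metis matrix_mul_assoc matrix_mul_rid)

lemma unitary_group_adj: "U \<in> unitary_group \<Longrightarrow> adj U \<in> unitary_group"
  by (simp add: unitary_group_iff adj_adj)

lemma pauli_entries:
  "pauli 1 $ 1 $ 1 = 0" "pauli 1 $ 1 $ 2 = 1" "pauli 1 $ 2 $ 1 = 1" "pauli 1 $ 2 $ 2 = 0"
  "pauli 2 $ 1 $ 1 = 0" "pauli 2 $ 1 $ 2 = - \<i>" "pauli 2 $ 2 $ 1 = \<i>" "pauli 2 $ 2 $ 2 = 0"
  "pauli 3 $ 1 $ 1 = 1" "pauli 3 $ 1 $ 2 = 0" "pauli 3 $ 2 $ 1 = 0" "pauli 3 $ 2 $ 2 = -1"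
  by (simp_all add: pauli_simps vector_2)

lemma three_cases: "P 1 \<Longrightarrow> P 2 \<Longrightarrow> P 3 \<Longrightarrow> P (i::3)"
  by (metis exhaust_3)

lemma pauli_hermitian: "adj (pauli i) = pauli i"
  by (rule three_cases[of _ i]; simp add: vec_eq_iff forall_2 adj_def pauli_entries)

lemma trace_pauli: "trace (pauli i) = 0"
  by (rule three_cases[of _ i]; simp add: trace_def sum_2 pauli_entries)

lemma trace_pauli_mult: "trace (pauli j ** pauli i) = (if i = j then 2 else 0)"
  by (rule three_cases[of _ i]; rule three_cases[of _ j];
      simp add: trace_def sum_2 matrix_matrix_mult_def pauli_entries)

text \<open>The Pauli matrices form an orthogonal basis of the real space of traceless Hermitian
  matrices for the trace form, each of squared length 2.\<close>

lemma pauli_expansion: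
  assumes "adj M = M" "trace M = 0"
  shows "M = (\<Sum>j\<in>UNIV. (Re (trace (pauli j ** M)) / 2) *\<^sub>R pauli j)"
proof -
  have adj: "cnj (M $ j $ i) = M $ i $ j" for i j
    using arg_cong[OF assms(1), of "\<lambda>A. A $ i $ j"] by (simp add: adj_def)
  have re: "Re (M $ 2 $ 1) = Re (M $ 1 $ 2)" "Im (M $ 2 $ 1) = - Im (M $ 1 $ 2)"
      "Im (M $ 1 $ 1) = 0" "Im (M $ 2 $ 2) = 0"
    using adj[of 1 2] adj[of 1 1] adj[of 2 2] by (auto simp: complex_eq_iff)
  have tr: "Re (M $ 2 $ 2) = - Re (M $ 1 $ 1)"
    using assms(2) by (simp add: trace_def sum_2 complex_eq_iff)
  have T: "trace (pauli 1 ** M) = M $ 2 $ 1 + M $ 1 $ 2"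
      "trace (pauli 2 ** M) = - \<i> * M $ 2 $ 1 + \<i> * M $ 1 $ 2"
      "trace (pauli 3 ** M) = M $ 1 $ 1 - M $ 2 $ 2"
    by (simp_all add: trace_def sum_2 matrix_matrix_mult_def pauli_entries)
  show ?thesis
    unfolding vec_eq_iff forall_2
    by (simp add: sum_3 T pauli_entries complex_eq_iff re tr)
qed

lemma pauli_coeff:
  "Re (trace (pauli k ** (\<Sum>j\<in>UNIV. r j *\<^sub>R pauli j))) / 2 = r k"
  by (rule three_cases[of _ k];
      simp add: trace_def sum_2 sum_3 matrix_matrix_mult_def pauli_entries)

lemma trace_adjoint_action: "U \<in> unitary_group \<Longrightarrow> trace (adj U ** A ** U) = trace A"
  by (metis unitary_group_iff matrix_mul_assoc matrix_mul_lid trace_mul_sym)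

lemma pauli_rotation:
  assumes "U \<in> unitary_group"
  shows "adj U ** pauli i ** U = (\<Sum>j\<in>UNIV. rot_of U $ i $ j *\<^sub>R pauli j)"
  unfolding rot_of_def vec_lambda_beta
  by (rule pauli_expansion)
    (simp_all add: adj_mult adj_adj pauli_hermitian matrix_mul_assoc trace_adjoint_action[OF assms] trace_pauli)

lemma matrix_mult_sum_scale:
  fixes A D :: "complex^'n^'n"
  shows "A ** (\<Sum>j\<in>S. c j *\<^sub>R B j) ** D = (\<Sum>j\<in>S. c j *\<^sub>R (A ** B j ** D))"
proof (induction S rule: infinite_finite_induct)
  case (insert j S)
  have "A ** (c j *\<^sub>R B j) ** D = c j *\<^sub>R (A ** B j ** D)"
    by (simp add: vec_eq_iff matrix_matrix_mult_def sum_distrib_left sum_distrib_right scaleR_sum_right)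
  moreover have "A ** (B + B') ** D = A ** B ** D + A ** B' ** D" for B B' :: "complex^'n^'n"
    by (simp add: vec_eq_iff matrix_matrix_mult_def distrib_left distrib_right sum.distrib)
  ultimately show ?case
    using insert by simp
qed (simp_all add: vec_eq_iff matrix_matrix_mult_def)

lemma rot_of_mult:
  assumes "V \<in> unitary_group" "U \<in> unitary_group"
  shows "rot_of (V ** U) = rot_of V ** rot_of U"
proof -
  have "rot_of (V ** U) $ i $ k = (rot_of V ** rot_of U) $ i $ k" for i k
  proof -
    have "adj (V ** U) ** pauli i ** (V ** U) = adj U ** (adj V ** pauli i ** V) ** U"
      by (simp add: adj_mult matrix_mul_assoc)
    also have "\<dots> = (\<Sum>j\<in>UNIV. rot_of V $ i $ j *\<^sub>R (adj U ** pauli j ** U))"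
      by (simp add: pauli_rotation[OF assms(1)] matrix_mult_sum_scale)
    also have "\<dots> = (\<Sum>k\<in>UNIV. (rot_of V ** rot_of U) $ i $ k *\<^sub>R pauli k)"
      by (simp only: pauli_rotation[OF assms(2)])
        (simp add: sum_3 matrix_matrix_mult_def scaleR_add_right scaleR_add_left add_ac)
    finally have "rot_of (V ** U) $ i $ k =
      Re (trace (pauli k ** (\<Sum>k\<in>UNIV. (rot_of V ** rot_of U) $ i $ k *\<^sub>R pauli k))) / 2"
      by (simp add: rot_of_def)
    then show ?thesis
      by (simp only: pauli_coeff)
  qed
  then show ?thesis
    by (simp add: vec_eq_iff)
qed

lemma adj_one: "adj (mat 1) = mat 1"
  by (simp add: adj_def mat_def vec_eq_iff)

lemma rot_of_one: "rot_of (mat 1) = mat 1"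
  by (simp add: rot_of_def adj_one trace_pauli_mult vec_eq_iff) (simp add: mat_def)

text \<open>Cyclicity of the trace exchanges the roles of the two Pauli matrices.\<close>

lemma rot_of_adj: "rot_of (adj U) = transpose (rot_of U)"
proof -
  have "trace (pauli j ** (U ** pauli i ** adj U)) = trace (pauli i ** (adj U ** pauli j ** U))" for i j
    by (metis matrix_mul_assoc trace_mul_sym)
  then show ?thesis
    by (simp add: rot_of_def transpose_def adj_adj vec_eq_iff)
qed

lemma trace_mult3:
  fixes A B C :: op2
  shows "trace (A ** B ** C) =
      (A$1$1 * B$1$1 + A$1$2 * B$2$1) * C$1$1 + (A$1$1 * B$1$2 + A$1$2 * B$2$2) * C$2$1
    + (A$2$1 * B$1$1 + A$2$2 * B$2$1) * C$1$2 + (A$2$1 * B$1$2 + A$2$2 * B$2$2) * C$2$2"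
  by (simp add: trace_def sum_2 matrix_matrix_mult_def)

text \<open>For real combinations of Pauli matrices, the imaginary part of the trace of a triple
  product is twice the determinant of the coefficient rows. Conjugation preserves this trace, which
  is 2 * \<i> for the Pauli matrices themselves.\<close>

lemma det_rot_of:
  assumes "U \<in> unitary_group"
  shows "det (rot_of U) = 1"
proof -
  have "trace ((adj U ** pauli 1 ** U) ** (adj U ** pauli 2 ** U) ** (adj U ** pauli 3 ** U))
      = trace (adj U ** (pauli 1 ** pauli 2 ** pauli 3) ** U)"
  proof -
    have cancel: "A ** U ** (adj U ** B) = A ** B" for A B
      using assms by (metis unitary_group_iff matrix_mul_assoc matrix_mul_rid)
    have "(adj U ** pauli 1 ** U) ** (adj U ** pauli 2 ** U) = adj U ** pauli 1 ** (pauli 2 ** U)"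
      using cancel[of "adj U ** pauli 1" "pauli 2 ** U"] by (simp only: matrix_mul_assoc)
    then show ?thesis
      using cancel[of "adj U ** pauli 1 ** pauli 2" "pauli 3 ** U"] by (simp only: matrix_mul_assoc)
  qed
  also have "\<dots> = 2 * \<i>"
    by (simp add: trace_adjoint_action[OF assms]) (simp add: trace_def sum_2 matrix_matrix_mult_def pauli_entries)
  finally have *: "Im (trace ((adj U ** pauli 1 ** U) ** (adj U ** pauli 2 ** U) ** (adj U ** pauli 3 ** U))) = 2"
    by simp
  have entries: "(\<Sum>j\<in>UNIV. r j *\<^sub>R pauli j) $ 1 $ 1 = of_real (r 3)"
      "(\<Sum>j\<in>UNIV. r j *\<^sub>R pauli j) $ 1 $ 2 = Complex (r 1) (- r 2)"
      "(\<Sum>j\<in>UNIV. r j *\<^sub>R pauli j) $ 2 $ 1 = Complex (r 1) (r 2)"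
      "(\<Sum>j\<in>UNIV. r j *\<^sub>R pauli j) $ 2 $ 2 = - of_real (r 3)" for r
    by (simp_all add: sum_3 pauli_entries complex_eq_iff)
  have "2 * det (rot_of U) = 2"
    using *[unfolded pauli_rotation[OF assms] trace_mult3 entries] unfolding det_3
    by (simp add: algebra_simps)
  then show ?thesis
    by simp
qed

text \<open>Taking the image of the unitary group makes every rotation lift to a unitary by
  construction, and compactness and the group laws are inherited from there.\<close>

definition rotations :: "(real^3^3) set" where
  "rotations = rot_of ` unitary_group"

lemma rotations_mult: "R \<in> rotations \<Longrightarrow> S \<in> rotations \<Longrightarrow> R ** S \<in> rotations"
  unfolding rotations_def by (metis (no_types, lifting) image_iff rot_of_mult unitary_group_mult)

lemma rotations_transpose: "R \<in> rotations \<Longrightarrow> transpose R \<in> rotations"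
  unfolding rotations_def by (metis (no_types, lifting) image_iff rot_of_adj unitary_group_adj)

lemma rotations_one: "mat 1 \<in> rotations"
  unfolding rotations_def
  by (rule image_eqI[where x = "mat 1"]) (simp_all add: rot_of_one unitary_group_iff adj_one)

lemma rotations_orthogonal:
  assumes "R \<in> rotations"
  shows "R ** transpose R = mat 1" "transpose R ** R = mat 1"
  using assms unfolding rotations_def
  by (auto simp flip: rot_of_adj rot_of_mult simp: unitary_group_adj)
    (simp_all add: unitary_group_iff rot_of_one flip: rot_of_mult)

lemma rotations_det: "R \<in> rotations \<Longrightarrow> det R = 1"
  by (auto simp: rotations_def det_rot_of)

text \<open>The rows have norm one, so each of the four entries has modulus at most 1; the defining
  equations are closed conditions. Compactness supplies the maximum behind the singular value
  decomposition.\<close>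

lemma compact_unitary_group: "compact (unitary_group :: op2 set)"
proof -
  have "norm U \<le> 4" if "U \<in> unitary_group" for U :: op2
  proof -
    have entry: "norm (U $ i $ j) \<le> 1" for i j
    proof -
      have "(U ** adj U) $ i $ i = 1"
        using that by (simp add: unitary_group_iff mat_def)
      then have "U $ i $ 1 * cnj (U $ i $ 1) + U $ i $ 2 * cnj (U $ i $ 2) = 1"
        by (simp add: matrix_matrix_mult_def adj_def sum_2)
      then have "complex_of_real ((norm (U $ i $ 1))\<^sup>2 + (norm (U $ i $ 2))\<^sup>2) = 1"
        by (simp only: of_real_add complex_norm_square)
      then have "(norm (U $ i $ 1))\<^sup>2 + (norm (U $ i $ 2))\<^sup>2 = 1"
        using of_real_eq_1_iff by blast
      then have "(norm (U $ i $ 1))\<^sup>2 \<le> 1" "(norm (U $ i $ 2))\<^sup>2 \<le> 1"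
        using zero_le_power2[of "norm (U $ i $ 1)"] zero_le_power2[of "norm (U $ i $ 2)"] by linarith+
      then have "(norm (U $ i $ j))\<^sup>2 \<le> 1"
        using exhaust_2[of j] by auto
      then show ?thesis
        by (simp add: power_le_one_iff abs_square_le_1)
    qed
    have "norm U \<le> (\<Sum>i\<in>UNIV. norm (U $ i))"
      unfolding norm_vec_def[of U] by (rule L2_set_le_sum) simp
    also have "\<dots> \<le> (\<Sum>i\<in>UNIV. \<Sum>j\<in>UNIV. norm (U $ i $ j))"
      by (intro sum_mono) (unfold norm_vec_def[of "U $ _"], rule L2_set_le_sum, simp)
    also have "\<dots> \<le> (\<Sum>i\<in>(UNIV :: 2 set). \<Sum>j\<in>(UNIV :: 2 set). 1)"
      by (intro sum_mono entry)
    finally show ?thesis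
      by simp
  qed
  then have "bounded (unitary_group :: op2 set)"
    by (auto simp: bounded_iff)
  moreover have "closed {U :: op2. \<forall>i j. (U ** adj U) $ i $ j = mat 1 $ i $ j}"
    unfolding matrix_matrix_mult_def adj_def vec_lambda_beta
    by (intro closed_Collect_all closed_Collect_eq continuous_intros)
  moreover have "closed {U :: op2. \<forall>i j. (adj U ** U) $ i $ j = mat 1 $ i $ j}"
    unfolding matrix_matrix_mult_def adj_def vec_lambda_beta
    by (intro closed_Collect_all closed_Collect_eq continuous_intros)
  ultimately show ?thesis
    by (simp add: unitary_group_def compact_eq_bounded_closed Collect_conj_eq closed_Int vec_eq_iff)
qed

lemma continuous_rot_of: "continuous_on S rot_of"
  unfolding rot_of_def trace_def matrix_matrix_mult_def adj_def vec_lambda_beta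
  by (intro continuous_intros) simp_all

lemma compact_rotations: "compact rotations"
  unfolding rotations_def using compact_unitary_group continuous_rot_of by (rule compact_continuous_image[rotated])

section \<open>Rotations about the coordinate axes\<close>

definition rot3 :: "real \<Rightarrow> real^3^3" where
  "rot3 t = vector [vector [cos t, - sin t, 0], vector [sin t, cos t, 0], vector [0, 0, 1]]"

text \<open>The block on coordinates 1 and 3 has the same form as the blocks of \<open>rot1\<close>
  and \<open>rot3\<close>, so that \<open>jacobi_step\<close> can use one lemma for all three
  planes. This orients \<open>rot2\<close> against the right-hand rule, whence the minus sign in
  \<open>rot_of_spin\<close>.\<close>

definition rot2 :: "real \<Rightarrow> real^3^3" where
  "rot2 t = vector [vector [cos t, 0, - sin t], vector [0, 1, 0], vector [sin t, 0, cos t]]"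

definition rot1 :: "real \<Rightarrow> real^3^3" where
  "rot1 t = vector [vector [1, 0, 0], vector [0, cos t, - sin t], vector [0, sin t, cos t]]"

text \<open>This is the exponential of -\<i> t \<open>pauli k\<close>, because
  \<open>pauli k\<close> squares to the identity. Conjugation doubles the angle.\<close>

definition spin :: "3 \<Rightarrow> real \<Rightarrow> op2" where
  "spin k t = (\<chi> i j. of_real (cos t) * mat 1 $ i $ j - \<i> * of_real (sin t) * pauli k $ i $ j)"

lemma spin_unitary: "spin k t \<in> unitary_group"
proof -
  have s: "complex_of_real (sin t) * of_real (sin t) = 1 - of_real (cos t) * of_real (cos t)"
    using sin_squared_eq[of t] unfolding power2_eq_square by (metis of_real_1 of_real_diff of_real_mult)
  show ?thesis
    by (rule three_cases[of _ k]; simp add: unitary_group_iff vec_eq_iff forall_2 matrix_matrix_mult_def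
        adj_def mat_def sum_2 spin_def pauli_entries algebra_simps s)
qed

lemma rot_of_spin:
  "rot_of (spin 3 t) = rot3 (2 * t)"
  "rot_of (spin 2 t) = rot2 (- (2 * t))"
  "rot_of (spin 1 t) = rot1 (2 * t)"
proof -
  have s: "sin t * sin t = 1 - cos t * cos t"
    using sin_squared_eq[of t] by (simp add: power2_eq_square)
  have d: "sin (2 * t) = 2 * sin t * cos t" "cos (2 * t) = 2 * cos t * cos t - 1"
    by (simp_all add: sin_double cos_double power2_eq_square s)
  show "rot_of (spin 3 t) = rot3 (2 * t)"
    unfolding rot3_def d
    by (simp add: s vec_eq_iff forall_3 rot_of_def trace_def sum_2 matrix_matrix_mult_def
        adj_def mat_def spin_def pauli_entries power2_eq_square vector_3 algebra_simps)
  show "rot_of (spin 2 t) = rot2 (- (2 * t))"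
    unfolding rot2_def cos_minus sin_minus d
    by (simp add: s vec_eq_iff forall_3 rot_of_def trace_def sum_2 matrix_matrix_mult_def
        adj_def mat_def spin_def pauli_entries power2_eq_square vector_3 algebra_simps)
  show "rot_of (spin 1 t) = rot1 (2 * t)"
    unfolding rot1_def d
    by (simp add: s vec_eq_iff forall_3 rot_of_def trace_def sum_2 matrix_matrix_mult_def
        adj_def mat_def spin_def pauli_entries power2_eq_square vector_3 algebra_simps)
qed

lemma axis_rotations: "rot1 t \<in> rotations" "rot2 t \<in> rotations" "rot3 t \<in> rotations"
proof -
  have "rot1 t = rot_of (spin 1 (t / 2))" "rot2 t = rot_of (spin 2 (- t / 2))"
      "rot3 t = rot_of (spin 3 (t / 2))"
    by (simp_all add: rot_of_spin)
  then show "rot1 t \<in> rotations" "rot2 t \<in> rotations" "rot3 t \<in> rotations"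
    unfolding rotations_def using spin_unitary by auto
qed


section \<open>Diagonalisation by two-sided rotations\<close>

definition diag3 :: "'a::comm_ring_1 \<Rightarrow> 'a \<Rightarrow> 'a \<Rightarrow> 'a^3^3" where
  "diag3 a b c = vector [vector [a, 0, 0], vector [0, b, 0], vector [0, 0, c]]"

lemma diag3_nth [simp]:
  "diag3 a b c $ 1 $ 1 = a" "diag3 a b c $ 1 $ 2 = 0" "diag3 a b c $ 1 $ 3 = 0"
  "diag3 a b c $ 2 $ 1 = 0" "diag3 a b c $ 2 $ 2 = b" "diag3 a b c $ 2 $ 3 = 0"
  "diag3 a b c $ 3 $ 1 = 0" "diag3 a b c $ 3 $ 2 = 0" "diag3 a b c $ 3 $ 3 = c"
  by (simp_all add: diag3_def vector_3)

lemma ex_angle: "\<exists>t. x * sin t + y * cos t = (0::real)"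
proof (cases "x = 0")
  case True
  then show ?thesis
    by (intro exI[of _ "pi / 2"]) simp
next
  case False
  have "sin (arctan (- y / x)) = - y / x * cos (arctan (- y / x))"
    using tan_arctan[of "- y / x"] by (simp add: tan_def field_simps)
  then show ?thesis
    using False by (intro exI[of _ "arctan (- y / x)"]) simp
qed

text \<open>In the coordinates \<open>z \<mapsto> p z + q cnj z\<close> on \<open>2 \<times> 2\<close> matrices the two rotations multiply
  \<open>p\<close> and \<open>q\<close> by \<open>cis (s + t)\<close> and \<open>cis (s - t)\<close>, so both can be made real.\<close>

lemma two_sided_rotation_diagonalises:
  fixes a b c d :: real
  obtains s t where
    "cos t * (cos s * b - sin s * d) - sin t * (cos s * a - sin s * c) = 0"
    "cos t * (sin s * a + cos s * c) + sin t * (sin s * b + cos s * d) = 0"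
    "(cos t * (cos s * a - sin s * c) + sin t * (cos s * b - sin s * d))\<^sup>2
      + (cos t * (sin s * b + cos s * d) - sin t * (sin s * a + cos s * c))\<^sup>2
      = a\<^sup>2 + b\<^sup>2 + c\<^sup>2 + d\<^sup>2"
proof -
  \<comment> \<open>The difference of the new off-diagonal entries depends on \<open>s + t\<close>
    alone and their sum on \<open>s - t\<close> alone, so the two angles can be chosen
    independently.\<close>
  obtain u where u: "(a + d) * sin u + (c - b) * cos u = 0"
    using ex_angle by blast
  obtain v where v: "(a - d) * sin v + (b + c) * cos v = 0"
    using ex_angle by blast
  define s where "s = (u + v) / 2"
  define t where "t = (u - v) / 2"
  have uv: "u = s + t" "v = s - t"
    by (simp_all add: s_def t_def field_simps)
  define b' where "b' = cos t * (cos s * b - sin s * d) - sin t * (cos s * a - sin s * c)"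
  define c' where "c' = cos t * (sin s * a + cos s * c) + sin t * (sin s * b + cos s * d)"
  have "c' - b' = (a + d) * sin u + (c - b) * cos u"
    unfolding b'_def c'_def uv sin_add cos_add by (simp add: algebra_simps)
  moreover have "c' + b' = (a - d) * sin v + (b + c) * cos v"
    unfolding b'_def c'_def uv sin_diff cos_diff by (simp add: algebra_simps)
  ultimately have 0: "b' = 0" "c' = 0"
    using u v by simp_all
  \<comment> \<open>The sum of squares of all four entries is preserved. The factors equal to 1 are
    kept so that this is an identity of polynomials in the sines and cosines.\<close>
  have "(cos t * (cos s * a - sin s * c) + sin t * (cos s * b - sin s * d))\<^sup>2
      + (cos t * (sin s * b + cos s * d) - sin t * (sin s * a + cos s * c))\<^sup>2 + b'\<^sup>2 + c'\<^sup>2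
      = (a\<^sup>2 + b\<^sup>2 + c\<^sup>2 + d\<^sup>2) * ((sin s)\<^sup>2 + (cos s)\<^sup>2) * ((sin t)\<^sup>2 + (cos t)\<^sup>2)"
    unfolding b'_def c'_def by algebra
  then show ?thesis
    using that[of t s] 0 by (simp add: b'_def c'_def)
qed

definition diag_norm :: "real^3^3 \<Rightarrow> real" where
  "diag_norm M = (M $ 1 $ 1)\<^sup>2 + (M $ 2 $ 2)\<^sup>2 + (M $ 3 $ 3)\<^sup>2"

lemmas axis_simps = matrix_matrix_mult_def sum_3 rot1_def rot2_def rot3_def vector_3 diag_norm_def

text \<open>One step of Jacobi's method: rotating in the plane of a nonzero off-diagonal pair clears
  that pair. The 2 by 2 block keeps its sum of squares and the remaining diagonal entry is fixed, so
  the squares of the cleared pair are gained on the diagonal.\<close>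

lemma jacobi_step:
  fixes M :: "real^3^3"
  assumes "\<And>a b c. M \<noteq> diag3 a b c"
  obtains R S where "R \<in> rotations" "S \<in> rotations" "diag_norm M < diag_norm (R ** M ** S)"
proof -
  have pos: "0 < x\<^sup>2 + y\<^sup>2" if "x \<noteq> 0 \<or> y \<noteq> 0" for x y :: real
    using that by (simp add: sum_power2_gt_zero_iff)
  consider "M $ 1 $ 2 \<noteq> 0 \<or> M $ 2 $ 1 \<noteq> 0" | "M $ 1 $ 3 \<noteq> 0 \<or> M $ 3 $ 1 \<noteq> 0"
    | "M $ 2 $ 3 \<noteq> 0 \<or> M $ 3 $ 2 \<noteq> 0"
    using assms[of "M $ 1 $ 1" "M $ 2 $ 2" "M $ 3 $ 3"] by (auto simp: vec_eq_iff forall_3)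
  then show ?thesis
  proof cases
    case 1
    obtain s t where st:
      "(cos t * (cos s * M$1$1 - sin s * M$2$1) + sin t * (cos s * M$1$2 - sin s * M$2$2))\<^sup>2
      + (cos t * (sin s * M$1$2 + cos s * M$2$2) - sin t * (sin s * M$1$1 + cos s * M$2$1))\<^sup>2
      = (M$1$1)\<^sup>2 + (M$1$2)\<^sup>2 + (M$2$1)\<^sup>2 + (M$2$2)\<^sup>2"
      using two_sided_rotation_diagonalises by blast
    have "diag_norm (rot3 s ** M ** rot3 t) =
      (cos t * (cos s * M$1$1 - sin s * M$2$1) + sin t * (cos s * M$1$2 - sin s * M$2$2))\<^sup>2
      + (cos t * (sin s * M$1$2 + cos s * M$2$2) - sin t * (sin s * M$1$1 + cos s * M$2$1))\<^sup>2
      + (M$3$3)\<^sup>2"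
      by (simp add: axis_simps algebra_simps)
    then have "diag_norm M < diag_norm (rot3 s ** M ** rot3 t)"
      using pos[OF 1] unfolding st by (simp add: diag_norm_def)
    then show ?thesis
      using that axis_rotations by blast
  next
    case 2
    obtain s t where st:
      "(cos t * (cos s * M$1$1 - sin s * M$3$1) + sin t * (cos s * M$1$3 - sin s * M$3$3))\<^sup>2
      + (cos t * (sin s * M$1$3 + cos s * M$3$3) - sin t * (sin s * M$1$1 + cos s * M$3$1))\<^sup>2
      = (M$1$1)\<^sup>2 + (M$1$3)\<^sup>2 + (M$3$1)\<^sup>2 + (M$3$3)\<^sup>2"
      using two_sided_rotation_diagonalises by blast
    have "diag_norm (rot2 s ** M ** rot2 t) =
      (cos t * (cos s * M$1$1 - sin s * M$3$1) + sin t * (cos s * M$1$3 - sin s * M$3$3))\<^sup>2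
      + (cos t * (sin s * M$1$3 + cos s * M$3$3) - sin t * (sin s * M$1$1 + cos s * M$3$1))\<^sup>2
      + (M$2$2)\<^sup>2"
      by (simp add: axis_simps algebra_simps)
    then have "diag_norm M < diag_norm (rot2 s ** M ** rot2 t)"
      using pos[OF 2] unfolding st by (simp add: diag_norm_def)
    then show ?thesis
      using that axis_rotations by blast
  next
    case 3
    obtain s t where st:
      "(cos t * (cos s * M$2$2 - sin s * M$3$2) + sin t * (cos s * M$2$3 - sin s * M$3$3))\<^sup>2
      + (cos t * (sin s * M$2$3 + cos s * M$3$3) - sin t * (sin s * M$2$2 + cos s * M$3$2))\<^sup>2
      = (M$2$2)\<^sup>2 + (M$2$3)\<^sup>2 + (M$3$2)\<^sup>2 + (M$3$3)\<^sup>2"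
      using two_sided_rotation_diagonalises by blast
    have "diag_norm (rot1 s ** M ** rot1 t) =
      (cos t * (cos s * M$2$2 - sin s * M$3$2) + sin t * (cos s * M$2$3 - sin s * M$3$3))\<^sup>2
      + (cos t * (sin s * M$2$3 + cos s * M$3$3) - sin t * (sin s * M$2$2 + cos s * M$3$2))\<^sup>2
      + (M$1$1)\<^sup>2"
      by (simp add: axis_simps algebra_simps)
    then have "diag_norm M < diag_norm (rot1 s ** M ** rot1 t)"
      using pos[OF 3] unfolding st by (simp add: diag_norm_def)
    then show ?thesis
      using that axis_rotations by blast
  qed
qed

definition orbit_equiv :: "real^3^3 \<Rightarrow> real^3^3 \<Rightarrow> bool" where
  "orbit_equiv C D \<longleftrightarrow> (\<exists>R\<in>rotations. \<exists>S\<in>rotations. D = R ** C ** S)"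

lemma orbit_equivI: "R \<in> rotations \<Longrightarrow> S \<in> rotations \<Longrightarrow> orbit_equiv C (R ** C ** S)"
  unfolding orbit_equiv_def by blast

lemma orbit_equiv_trans:
  assumes "orbit_equiv C D" "orbit_equiv D E"
  shows "orbit_equiv C E"
proof -
  obtain R S R' S' where *: "R \<in> rotations" "S \<in> rotations" "R' \<in> rotations" "S' \<in> rotations"
      "D = R ** C ** S" "E = R' ** D ** S'"
    using assms unfolding orbit_equiv_def by blast
  then have "E = (R' ** R) ** C ** (S ** S')"
    by (simp only: matrix_mul_assoc)
  then show ?thesis
    using * by (auto intro: orbit_equivI rotations_mult)
qed

lemma orbit_equiv_sym:
  assumes "orbit_equiv C D"
  shows "orbit_equiv D C"
proof -
  obtain R S where *: "R \<in> rotations" "S \<in> rotations" "D = R ** C ** S"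
    using assms unfolding orbit_equiv_def by blast
  have "transpose R ** D ** transpose S = (transpose R ** R) ** C ** (S ** transpose S)"
    unfolding *(3) by (simp only: matrix_mul_assoc)
  also have "\<dots> = C"
    using * by (simp add: rotations_orthogonal)
  finally show ?thesis
    using * by (metis orbit_equivI rotations_transpose)
qed

text \<open>By compactness \<open>diag_norm\<close> has a maximum on the orbit, and
  \<open>jacobi_step\<close> shows that a maximiser is diagonal. Since both factors have determinant
  1, the diagonal entries keep signs, unlike the usual singular values.\<close>

lemma singular_value_decomposition: "\<exists>a b c. orbit_equiv (diag3 a b c) C"
proof -
  have "compact (rotations \<times> rotations)"
    by (intro compact_Times compact_rotations)
  moreover have "rotations \<times> rotations \<noteq> {}"
    using rotations_one by blast
  moreover have "continuous_on (rotations \<times> rotations) (\<lambda>(R, S). diag_norm (R ** C ** S))"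
    unfolding diag_norm_def matrix_matrix_mult_def vec_lambda_beta case_prod_beta
    by (intro continuous_intros)
  ultimately have "\<exists>x\<in>rotations \<times> rotations. \<forall>y\<in>rotations \<times> rotations.
      (\<lambda>(R, S). diag_norm (R ** C ** S)) y \<le> (\<lambda>(R, S). diag_norm (R ** C ** S)) x"
    by (rule continuous_attains_sup)
  then obtain R S where RS: "R \<in> rotations" "S \<in> rotations"
    and max: "\<And>R' S'. R' \<in> rotations \<Longrightarrow> S' \<in> rotations \<Longrightarrow>
      diag_norm (R' ** C ** S') \<le> diag_norm (R ** C ** S)"
    unfolding split_beta by (auto simp: Ball_def Bex_def)
  have "\<exists>a b c. R ** C ** S = diag3 a b c"
  proof (rule ccontr)
    assume "\<nexists>a b c. R ** C ** S = diag3 a b c"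
    then obtain R' S' where *: "R' \<in> rotations" "S' \<in> rotations"
        "diag_norm (R ** C ** S) < diag_norm (R' ** (R ** C ** S) ** S')"
      using jacobi_step by metis
    moreover have "R' ** (R ** C ** S) ** S' = (R' ** R) ** C ** (S ** S')"
      by (simp only: matrix_mul_assoc)
    ultimately show False
      using max[of "R' ** R" "S ** S'"] RS by (simp add: rotations_mult)
  qed
  then show ?thesis
    using RS by (metis orbit_equivI orbit_equiv_sym)
qed

text \<open>A half turn about an axis flips the other two signs. Conjugation by a quarter turn swaps
  two entries, the signs of the two quarter turns cancelling.\<close>

lemma orbit_equiv_diag3:
  "orbit_equiv (diag3 a b c) (diag3 (- a) (- b) c)"
  "orbit_equiv (diag3 a b c) (diag3 (- a) b (- c))"
  "orbit_equiv (diag3 a b c) (diag3 a (- b) (- c))"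
  "orbit_equiv (diag3 a b c) (diag3 b a c)"
  "orbit_equiv (diag3 a b c) (diag3 c b a)"
  "orbit_equiv (diag3 a b c) (diag3 a c b)"
proof -
  have "diag3 (- a) (- b) c = rot3 pi ** diag3 a b c ** mat 1"
      "diag3 (- a) b (- c) = rot2 pi ** diag3 a b c ** mat 1"
      "diag3 a (- b) (- c) = rot1 pi ** diag3 a b c ** mat 1"
      "diag3 b a c = rot3 (pi / 2) ** diag3 a b c ** rot3 (- (pi / 2))"
      "diag3 c b a = rot2 (pi / 2) ** diag3 a b c ** rot2 (- (pi / 2))"
      "diag3 a c b = rot1 (pi / 2) ** diag3 a b c ** rot1 (- (pi / 2))"
    by (simp_all add: vec_eq_iff forall_3 axis_simps mat_def)
  then show
    "orbit_equiv (diag3 a b c) (diag3 (- a) (- b) c)"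
    "orbit_equiv (diag3 a b c) (diag3 (- a) b (- c))"
    "orbit_equiv (diag3 a b c) (diag3 a (- b) (- c))"
    "orbit_equiv (diag3 a b c) (diag3 b a c)"
    "orbit_equiv (diag3 a b c) (diag3 c b a)"
    "orbit_equiv (diag3 a b c) (diag3 a c b)"
    using axis_rotations rotations_one by (metis orbit_equivI)+
qed


section \<open>The correlation matrix\<close>

definition corr_mat :: "op4 \<Rightarrow> real^3^3" where
  "corr_mat \<rho> = (\<chi> i j. corr i j \<rho>)"

lemma sum_UNIV_prod: "(\<Sum>r\<in>UNIV. f (fst r) (snd r)) = (\<Sum>i\<in>UNIV. \<Sum>k\<in>UNIV. f i k)"
  for f :: "'a::finite \<Rightarrow> 'b::finite \<Rightarrow> 'c::comm_monoid_add"
  by (simp add: sum.cartesian_product UNIV_Times_UNIV case_prod_beta)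

lemma tensor_op_mult: "tensor_op a b ** tensor_op c d = tensor_op (a ** c) (b ** d)"
proof -
  have "(\<Sum>s\<in>UNIV. a $ i $ fst s * b $ k $ snd s * (c $ fst s $ j * d $ snd s $ l))
      = (\<Sum>m\<in>UNIV. \<Sum>n\<in>UNIV. a $ i $ m * b $ k $ n * (c $ m $ j * d $ n $ l))" for i j k l
    by (rule sum_UNIV_prod)
  then show ?thesis
    by (simp add: tensor_op_def matrix_matrix_mult_def vec_eq_iff sum_product mult_ac)
qed

lemma adj_tensor_op: "adj (tensor_op a b) = tensor_op (adj a) (adj b)"
  by (simp add: tensor_op_def adj_def vec_eq_iff)

lemma trace_tensor_op: "trace (tensor_op a b) = trace a * trace b"
  using sum_UNIV_prod[of "\<lambda>i k. a $ i $ i * b $ k $ k"]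
  by (simp add: tensor_op_def trace_def sum_product)

lemma tensor_op_sum:
  "tensor_op (\<Sum>i\<in>I. r i *\<^sub>R A i) (\<Sum>j\<in>J. s j *\<^sub>R B j)
    = (\<Sum>i\<in>I. \<Sum>j\<in>J. (r i * s j) *\<^sub>R tensor_op (A i) (B j))"
  by (simp add: tensor_op_def vec_eq_iff sum_product mult.commute)

lemma tensor_op_one: "tensor_op (mat 1) (mat 1) = mat 1"
  by (auto simp: tensor_op_def mat_def vec_eq_iff prod_eq_iff)

lemma trace_mult_sum_scale:
  "trace (A ** (\<Sum>i\<in>I. r i *\<^sub>R B i)) = (\<Sum>i\<in>I. r i *\<^sub>R trace (A ** B i))"
  for A :: "complex^'n^'n"
proof (induction I rule: infinite_finite_induct)
  case (insert i I)
  have "trace (A ** (r i *\<^sub>R B i + D)) = r i *\<^sub>R trace (A ** B i) + trace (A ** D)" for D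
    by (simp add: trace_def matrix_matrix_mult_def distrib_left sum.distrib scaleR_sum_right)
  then show ?case
    using insert by simp
qed (simp_all add: trace_def matrix_matrix_mult_def)

text \<open>By cyclicity of the trace the local unitary moves from the state to the observables,
  where \<open>pauli_rotation\<close> expands both tensor factors.\<close>

lemma corr_mat_act:
  assumes "U \<in> unitary_group" "W \<in> unitary_group"
  shows "corr_mat (act U W \<rho>) = rot_of U ** corr_mat \<rho> ** transpose (rot_of W)"
proof -
  have "corr i j (act U W \<rho>) = (rot_of U ** corr_mat \<rho> ** transpose (rot_of W)) $ i $ j" for i j
  proof -
    let ?T = "tensor_op U W"
    have "trace (act U W \<rho> ** tensor_op (pauli i) (pauli j))
        = trace (\<rho> ** (adj ?T ** tensor_op (pauli i) (pauli j) ** ?T))"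
      unfolding act_def by (metis matrix_mul_assoc trace_mul_sym)
    also have "adj ?T ** tensor_op (pauli i) (pauli j) ** ?T
        = tensor_op (adj U ** pauli i ** U) (adj W ** pauli j ** W)"
      by (simp only: adj_tensor_op tensor_op_mult)
    \<comment> \<open>The factor 1 gives the outer sum the scaled form to which
      \<open>trace_mult_sum_scale\<close> applies.\<close>
    also have "\<dots> = (\<Sum>a\<in>UNIV. 1 *\<^sub>R (\<Sum>b\<in>UNIV. (rot_of U $ i $ a * rot_of W $ j $ b) *\<^sub>R tensor_op (pauli a) (pauli b)))"
      by (simp add: pauli_rotation[OF assms(1)] pauli_rotation[OF assms(2)] tensor_op_sum)
    finally have "corr i j (act U W \<rho>) = (\<Sum>a\<in>UNIV. \<Sum>b\<in>UNIV.
        (rot_of U $ i $ a * rot_of W $ j $ b) * corr a b \<rho>)"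
      unfolding corr_def trace_mult_sum_scale by simp
    also have "\<dots> = (rot_of U ** corr_mat \<rho> ** transpose (rot_of W)) $ i $ j"
      by (simp add: matrix_matrix_mult_def transpose_def corr_mat_def sum_3 algebra_simps)
    finally show ?thesis .
  qed
  then show ?thesis
    by (simp add: vec_eq_iff corr_mat_def)
qed

text \<open>The inverse of the coordinate map; 4 is the trace of the identity and of the square of
  each tensor product of Pauli matrices. Positivity is not part of \<open>lmm\<close>, so
  \<open>C\<close> may be any real matrix.\<close>

definition state_of :: "real^3^3 \<Rightarrow> op4" where
  "state_of C = (1 / 4) *\<^sub>R (mat 1 + (\<Sum>i\<in>UNIV. \<Sum>j\<in>UNIV. C $ i $ j *\<^sub>R tensor_op (pauli i) (pauli j)))"

lemma corr_mat_state_of: "corr_mat (state_of C) = C"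
proof -
  have "corr i j (state_of C) = C $ i $ j" for i j
  proof -
    let ?P = "tensor_op (pauli i) (pauli j)"
    have "trace (state_of C ** ?P) = trace (?P ** state_of C)"
      by (rule trace_mul_sym)
    also have "\<dots> = (1 / 4) *\<^sub>R trace (?P ** (mat 1 + (\<Sum>a\<in>UNIV. 1 *\<^sub>R (\<Sum>b\<in>UNIV. C $ a $ b *\<^sub>R tensor_op (pauli a) (pauli b)))))"
      by (simp add: state_of_def trace_def matrix_matrix_mult_def scaleR_sum_right)
    also have "\<dots> = (1 / 4) *\<^sub>R (trace ?P + (\<Sum>a\<in>UNIV. \<Sum>b\<in>UNIV.
        C $ a $ b *\<^sub>R (trace (pauli i ** pauli a) * trace (pauli j ** pauli b))))"
      unfolding matrix_add_ldistrib trace_add matrix_mul_rid trace_mult_sum_scale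
      by (simp only: tensor_op_mult trace_tensor_op scaleR_one)
    also have "\<dots> = of_real (C $ i $ j)"
      by (simp add: trace_tensor_op trace_pauli trace_pauli_mult)
        (simp add: mult_delta_left mult_delta_right scaleR_conv_of_real)
    finally show ?thesis
      by (simp add: corr_def)
  qed
  then show ?thesis
    by (simp add: vec_eq_iff corr_mat_def)
qed

text \<open>Pauli matrices are traceless, so only the identity term survives either partial
  trace.\<close>

lemma state_of_lmm: "state_of C \<in> lmm"
proof -
  have "adj (state_of C) = (1 / 4) *\<^sub>R (adj (mat 1) + (\<Sum>i\<in>UNIV. \<Sum>j\<in>UNIV. C $ i $ j *\<^sub>R adj (tensor_op (pauli i) (pauli j))))"
    by (simp add: state_of_def adj_def vec_eq_iff)
  then have "hermitian (state_of C)"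
    by (simp add: hermitian_def state_of_def adj_tensor_op pauli_hermitian adj_one)
  moreover have "ptrace1 (state_of C) = (1 / 4) *\<^sub>R (ptrace1 (tensor_op (mat 1) (mat 1))
      + (\<Sum>i\<in>UNIV. \<Sum>j\<in>UNIV. C $ i $ j *\<^sub>R ptrace1 (tensor_op (pauli i) (pauli j))))"
    unfolding tensor_op_one
    by (simp add: state_of_def ptrace1_def vec_eq_iff sum_2 sum_3 algebra_simps)
  then have 1: "ptrace1 (state_of C) = mat (1 / 2)"
    by (simp add: ptrace1_tensor_op trace_pauli vec_eq_iff) (simp add: mat_def trace_def scaleR_conv_of_real)
  moreover have "ptrace2 (state_of C) = (1 / 4) *\<^sub>R (ptrace2 (tensor_op (mat 1) (mat 1))
      + (\<Sum>i\<in>UNIV. \<Sum>j\<in>UNIV. C $ i $ j *\<^sub>R ptrace2 (tensor_op (pauli i) (pauli j))))"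
    unfolding tensor_op_one
    by (simp add: state_of_def ptrace2_def vec_eq_iff sum_2 sum_3 algebra_simps)
  then have "ptrace2 (state_of C) = mat (1 / 2)"
    by (simp add: ptrace2_tensor_op trace_pauli vec_eq_iff) (simp add: mat_def trace_def scaleR_conv_of_real)
  moreover have "trace \<rho> = trace (ptrace1 \<rho>)" for \<rho>
    using sum_UNIV_prod[of "\<lambda>i k. \<rho> $ (i, k) $ (i, k)"]
    by (simp add: trace_def ptrace1_def) (rule sum.swap)
  then have "trace (state_of C) = 1"
    by (simp add: 1) (simp add: trace_def mat_def)
  ultimately show ?thesis
    by (simp add: lmm_def liouville_def)
qed


section \<open>Polynomial invariants\<close>

definition mat_eval :: "coord rpoly \<Rightarrow> real^3^3 \<Rightarrow> real" where
  "mat_eval f C = peval (\<lambda>c. c) (\<lambda>v. C $ row v $ col v) f"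

lemma mat_eval_0: "mat_eval 0 C = 0"
  by (simp add: mat_eval_def peval_def)

lemma value_at_mat_eval: "value_at f \<rho> = mat_eval f (corr_mat \<rho>)"
  by (simp add: value_at_def mat_eval_def corr_mat_def)

lemma mat_eval_eq_imp_eq:
  assumes "\<And>C. mat_eval f C = mat_eval g C"
  shows "f = g"
proof (rule peval_eq_imp_eq)
  fix x :: "coord \<Rightarrow> real"
  show "peval (\<lambda>c. c) x f = peval (\<lambda>c. c) x g"
    using assms[of "\<chi> i j. x (Corr i j)"] by (simp add: mat_eval_def)
qed

lemma orbit_equiv_act:
  assumes "U \<in> unitary_group" "W \<in> unitary_group"
  shows "orbit_equiv (corr_mat \<rho>) (corr_mat (act U W \<rho>))"
  unfolding corr_mat_act[OF assms]
  using assms by (intro orbit_equivI rotations_transpose) (auto simp: rotations_def)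

lemma orbit_equiv_imp_act:
  assumes "orbit_equiv C D"
  obtains U W where "U \<in> unitary_group" "W \<in> unitary_group" "D = corr_mat (act U W (state_of C))"
proof -
  obtain R S where *: "R \<in> rotations" "transpose S \<in> rotations" "D = R ** C ** S"
    using assms rotations_transpose unfolding orbit_equiv_def by blast
  then obtain U W where "U \<in> unitary_group" "W \<in> unitary_group" "R = rot_of U" "transpose S = rot_of W"
    unfolding rotations_def by blast
  moreover from this have "S = transpose (rot_of W)"
    by (metis transpose_transpose)
  ultimately show ?thesis
    using that * by (simp add: corr_mat_act corr_mat_state_of)
qed

text \<open>Values depend only on the correlation matrix, and \<open>state_of\<close> realises every
  real matrix as one. States and unitaries can therefore be replaced by matrices and their
  orbits.\<close>

lemma invariant_ring_iff:
  "f \<in> invariant_ring \<longleftrightarrow> (\<forall>C D. orbit_equiv C D \<longrightarrow> mat_eval f D = mat_eval f C)"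
proof
  assume f: "f \<in> invariant_ring"
  show "\<forall>C D. orbit_equiv C D \<longrightarrow> mat_eval f D = mat_eval f C"
  proof (intro allI impI)
    fix C D
    assume "orbit_equiv C D"
    then obtain U W where "U \<in> unitary_group" "W \<in> unitary_group" "D = corr_mat (act U W (state_of C))"
      by (rule orbit_equiv_imp_act)
    with f state_of_lmm[of C] show "mat_eval f D = mat_eval f C"
      by (auto simp: invariant_ring_def value_at_mat_eval corr_mat_state_of)
  qed
next
  assume "\<forall>C D. orbit_equiv C D \<longrightarrow> mat_eval f D = mat_eval f C"
  then show "f \<in> invariant_ring"
    by (auto simp: invariant_ring_def value_at_mat_eval orbit_equiv_act)
qed

section \<open>The three basic invariants\<close>

fun invs :: "'k::comm_ring_1^3^3 \<Rightarrow> gen \<Rightarrow> 'k" where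
  "invs X t2 = trace (X ** transpose X)"
| "invs X t3 = det X"
| "invs X t4 = trace (X ** transpose X ** (X ** transpose X))"

text \<open>The invariants are polynomials with integer coefficients in the entries. They are needed
  over three rings: real matrices for values, complex ones for independence, and the generic matrix
  of indeterminates for \<open>inv_map\<close>.\<close>

lemma hom_invs:
  assumes "ring_hom_map h"
  shows "h (invs X g) = invs (\<chi> i j. h (X $ i $ j)) g"
  by (cases g) (simp_all add: det_3 trace_def matrix_matrix_mult_def transpose_def hom_simps[OF assms])

text \<open>The right factor cancels in the Gram matrix \<open>D ** transpose D\<close>, which is
  thus conjugated by \<open>R\<close>; the determinant is multiplicative and 1 on rotations.\<close>

lemma invs_orbit_equiv:
  fixes C D :: "real^3^3"
  assumes "orbit_equiv C D"
  shows "invs D = invs C"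
proof
  fix g
  obtain R S where *: "R \<in> rotations" "S \<in> rotations" "D = R ** C ** S"
    using assms unfolding orbit_equiv_def by blast
  let ?G = "C ** transpose C"
  have "D ** transpose D = R ** C ** (S ** transpose S) ** transpose C ** transpose R"
    unfolding *(3) matrix_transpose_mul by (simp only: matrix_mul_assoc)
  also have "\<dots> = R ** ?G ** transpose R"
    using * by (simp add: rotations_orthogonal matrix_mul_assoc)
  finally have gram: "D ** transpose D = R ** ?G ** transpose R" .
  have conj: "trace (R ** A ** transpose R) = trace A" for A
    using *(1) by (metis rotations_orthogonal(2) matrix_mul_assoc matrix_mul_lid trace_mul_sym)
  have "(R ** ?G ** transpose R) ** (R ** ?G ** transpose R) = R ** ?G ** (transpose R ** R) ** ?G ** transpose R"
    by (simp only: matrix_mul_assoc)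
  also have "\<dots> = R ** (?G ** ?G) ** transpose R"
    using * by (simp add: rotations_orthogonal matrix_mul_assoc)
  finally have gram2: "D ** transpose D ** (D ** transpose D) = R ** (?G ** ?G) ** transpose R"
    unfolding gram .
  show "invs D g = invs C g"
  proof (cases g)
    case t3
    then show ?thesis
      using * by (simp add: det_mul rotations_det)
  qed (simp_all add: gram2 conj, simp add: gram conj)
qed

lemma invs_diag3:
  "invs (diag3 a b c) t2 = a ^ 2 + b ^ 2 + c ^ 2"
  "invs (diag3 a b c) t3 = a * b * c"
  "invs (diag3 a b c) t4 = a ^ 4 + b ^ 4 + c ^ 4"
  by (simp_all add: det_3 trace_def matrix_matrix_mult_def transpose_def sum_3 power2_eq_square)
    (simp add: power4_eq_xxxx mult.assoc)

definition inv_map :: "gen rpoly \<Rightarrow> coord rpoly" where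
  "inv_map = peval pconst (invs (\<chi> i j. pvar (Corr i j)))"

lemma ring_hom_map_inv_map: "ring_hom_map inv_map"
  unfolding inv_map_def by (rule ring_hom_map_peval[OF ring_hom_map_pconst])

lemma inv_map_pconst: "inv_map (pconst c) = pconst c"
  unfolding inv_map_def by (rule peval_pconst[OF ring_hom_map_pconst])

text \<open>Evaluation at the entries of \<open>X\<close> is a homomorphism that sends the generic
  matrix to \<open>X\<close>. Allowing any \<open>\<iota>\<close> makes complex \<open>X\<close>
  available.\<close>

lemma peval_inv_map:
  assumes "ring_hom_map \<iota>"
  shows "peval \<iota> (\<lambda>v. X $ row v $ col v) (inv_map p) = peval \<iota> (invs X) p"
proof -
  have "peval \<iota> (\<lambda>v. X $ row v $ col v) (invs (\<chi> i j. pvar (Corr i j)) g) = invs X g" for g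
    by (simp add: hom_invs[OF ring_hom_map_peval[OF assms]] peval_pvar[OF assms] vec_lambda_eta)
  then show ?thesis
    unfolding inv_map_def by (simp add: peval_peval[OF assms])
qed

lemma mat_eval_inv_map: "mat_eval (inv_map p) C = peval (\<lambda>c. c) (invs C) p"
  unfolding mat_eval_def by (rule peval_inv_map[OF ring_hom_map_id])

lemma inv_map_invariant: "inv_map p \<in> invariant_ring"
  by (simp add: invariant_ring_iff mat_eval_inv_map invs_orbit_equiv)


section \<open>Injectivity and degrees of the map to the invariants\<close>

lemma monic_cubic_splits:
  fixes r s t :: complex
  obtains x y z where "x + y + z = r" "x * y + x * z + y * z = s" "x * y * z = t"
proof -
  \<comment> \<open>A root of the cubic leaves a quadratic with sum of roots \<open>r - x\<close>
    and product \<open>s - x * (r - x)\<close>, whose discriminant is the radicand of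
    \<open>d\<close> below.\<close>
  obtain x where "poly [:- t, s, - r, 1:] x = 0"
    using alg_closed_imp_poly_has_root[of "[:- t, s, - r, 1:]"] by auto
  then have x: "t = x * (s - x * (r - x))"
    by (simp add: algebra_simps)
  define d where "d = csqrt ((r - x)\<^sup>2 - 4 * (s - x * (r - x)))"
  define y where "y = ((r - x) + d) / 2"
  define z where "z = ((r - x) - d) / 2"
  have "d\<^sup>2 = (r - x)\<^sup>2 - 4 * (s - x * (r - x))"
    by (simp add: d_def)
  moreover have "4 * (y * z) = (r - x)\<^sup>2 - d\<^sup>2"
  proof -
    have twice: "2 * y = (r - x) + d" "2 * z = (r - x) - d"
      by (simp_all add: y_def z_def)
    have "4 * (y * z) = 2 * y * (2 * z)"
      by simp
    then show ?thesis
      unfolding twice by algebra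
  qed
  ultimately have "4 * (y * z) = 4 * (s - x * (r - x))"
    by simp
  then have yz: "y * z = s - x * (r - x)"
    unfolding mult_cancel_left by simp
  have yz': "y + z = r - x"
    by (simp add: y_def z_def field_simps)
  show ?thesis
  proof
    show "x + y + z = r"
      using yz' by (simp add: algebra_simps)
    have "x * y + x * z + y * z = x * (y + z) + y * z"
      by (simp add: algebra_simps)
    then show "x * y + x * z + y * z = s"
      unfolding yz yz' by simp
    show "x * y * z = t"
      using x yz by (simp add: mult.assoc)
  qed
qed

text \<open>For a diagonal matrix, the values prescribe the elementary symmetric functions of the
  squared entries; the second is half of \<open>t2\<close> squared minus \<open>t4\<close>. A cubic
  yields the squares, and square roots yield the entries.\<close>

lemma invs_complex_surj: "\<exists>X :: complex^3^3. invs X = x"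
proof -
  obtain p q r where pqr: "p + q + r = x t2"
      "p * q + p * r + q * r = ((x t2)\<^sup>2 - x t4) / 2" "p * q * r = (x t3)\<^sup>2"
    using monic_cubic_splits by blast
  define a b c where "a = csqrt p" and "b = csqrt q" and "c = csqrt r"
  have sq: "a\<^sup>2 = p" "b\<^sup>2 = q" "c\<^sup>2 = r"
    by (simp_all add: a_def b_def c_def)
  have "(a * b * c)\<^sup>2 = (x t3)\<^sup>2"
    using pqr(3) by (simp add: power_mult_distrib sq)
  \<comment> \<open>The product of the chosen roots is correct up to sign, which is repaired by
    negating \<open>a\<close>.\<close>
  then obtain a' where a': "a'\<^sup>2 = p" "a' * b * c = x t3"
    using sq(1) by (metis minus_mult_left power2_eq_iff power2_minus)
  have four: "a' ^ 4 = p\<^sup>2" "b ^ 4 = q\<^sup>2" "c ^ 4 = r\<^sup>2"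
    unfolding a'(1)[symmetric] sq[symmetric] by simp_all
  have two: "2 * (p * q + p * r + q * r) = (x t2)\<^sup>2 - x t4"
    unfolding pqr(2) by simp
  have "p\<^sup>2 + q\<^sup>2 + r\<^sup>2 = (p + q + r)\<^sup>2 - 2 * (p * q + p * r + q * r)"
    by algebra
  also have "\<dots> = x t4"
    unfolding pqr(1) two by simp
  finally have "p\<^sup>2 + q\<^sup>2 + r\<^sup>2 = x t4" .
  then have "invs (diag3 a' b c) g = x g" for g
    using pqr(1) by (cases g) (simp_all only: invs_diag3 a' sq four)
  then show ?thesis
    by blast
qed

text \<open>Each real point is hit by \<open>invs\<close> at a complex matrix, where the zero
  polynomial \<open>inv_map p\<close> gives the value of \<open>p\<close>; hence \<open>p\<close>
  vanishes at all real points.\<close>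

lemma inv_map_eq_0:
  assumes "inv_map p = 0"
  shows "p = 0"
proof (rule peval_zero_imp_zero)
  fix x :: "gen \<Rightarrow> real"
  obtain X :: "complex^3^3" where X: "invs X = (\<lambda>g. of_real (x g))"
    using invs_complex_surj by blast
  have "complex_of_real (peval (\<lambda>c. c) x p) = peval of_real (invs X) p"
    unfolding X by (rule hom_peval[OF ring_hom_map_of_real])
  also have "\<dots> = peval of_real (\<lambda>v. X $ row v $ col v) (inv_map p)"
    by (rule peval_inv_map[OF ring_hom_map_of_real, symmetric])
  also have "\<dots> = 0"
    using assms by (simp add: peval_def)
  finally show "peval (\<lambda>c. c) x p = 0"
    by simp
qed

lemma inj_inv_map: "inj inv_map"
proof (rule injI)
  fix p q
  assume "inv_map p = inv_map q"
  then have "inv_map (p - q) = 0"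
    by (simp add: hom_diff[OF ring_hom_map_inv_map])
  then show "p = q"
    using inv_map_eq_0 by fastforce
qed

lemma homogeneous_inv_map_iff: "homogeneous (\<lambda>_. 1) d (inv_map p) \<longleftrightarrow> homogeneous gen_degree d p"
proof -
  \<comment> \<open>\<open>q\<close> is the defect of the scaling law for \<open>p\<close>. Doubling
    a matrix multiplies each invariant by 2 to its degree, so \<open>inv_map q\<close> is the
    corresponding defect for \<open>inv_map p\<close>, and by injectivity both vanish
    together.\<close>
  define q where "q = peval pconst (\<lambda>g. pconst (2 ^ gen_degree g) * pvar g) p - pconst (2 ^ d) * p"
  have q: "peval (\<lambda>c. c) x q = peval (\<lambda>c. c) (\<lambda>g. 2 ^ gen_degree g * x g) p - 2 ^ d * peval (\<lambda>c. c) x p" for x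
    by (simp add: q_def peval_simps ring_hom_map_id peval_peval)
  have scale: "invs (\<chi> i j. 2 * C $ i $ j) g = 2 ^ gen_degree g * invs C g" for C :: "real^3^3" and g
    by (cases g)
      (simp_all add: det_3 trace_def matrix_matrix_mult_def transpose_def sum_3 algebra_simps)
  then have scale': "invs (\<chi> i j. 2 * C $ i $ j) = (\<lambda>g. 2 ^ gen_degree g * invs C g)" for C :: "real^3^3"
    by blast
  have "homogeneous (\<lambda>_. 1) d (inv_map p) \<longleftrightarrow>
    (\<forall>C. mat_eval (inv_map p) (\<chi> i j. 2 * C $ i $ j) = 2 ^ d * mat_eval (inv_map p) C)"
  proof -
    have "(\<forall>x :: coord \<Rightarrow> real. P x) \<longleftrightarrow> (\<forall>C :: real^3^3. P (\<lambda>v. C $ row v $ col v))" for P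
    proof
      assume *: "\<forall>C :: real^3^3. P (\<lambda>v. C $ row v $ col v)"
      show "\<forall>x. P x"
      proof
        fix x
        show "P x"
          using *[rule_format, of "\<chi> i j. x (Corr i j)"] by simp
      qed
    qed simp
    then show ?thesis
      unfolding homogeneous_iff_scaling by (simp add: mat_eval_def)
  qed
  also have "\<dots> \<longleftrightarrow> (\<forall>C. mat_eval (inv_map q) C = 0)"
    by (simp add: mat_eval_inv_map q scale')
  also have "\<dots> \<longleftrightarrow> inv_map q = 0"
    using mat_eval_eq_imp_eq[of "inv_map q" 0] by (auto simp: mat_eval_0)
  also have "\<dots> \<longleftrightarrow> q = 0"
    using inv_map_eq_0 by (auto simp: hom_zero[OF ring_hom_map_inv_map])
  also have "\<dots> \<longleftrightarrow> (\<forall>x. peval (\<lambda>c. c) x q = 0)"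
    using peval_zero_imp_zero[of q] by (auto simp: peval_def)
  also have "\<dots> \<longleftrightarrow> homogeneous gen_degree d p"
    by (simp add: homogeneous_iff_scaling q)
  finally show ?thesis .
qed


section \<open>Averaging over the Weyl group\<close>

text \<open>The permutations and even sign changes of \<open>(a, b, c)\<close> form the Weyl group of type
  \<open>D\<^sub>3\<close>, of order 24.\<close>

definition sign_sum :: "(real \<Rightarrow> real \<Rightarrow> real \<Rightarrow> real) \<Rightarrow> real \<Rightarrow> real \<Rightarrow> real \<Rightarrow> real" where
  "sign_sum F a b c = F a b c + F (- a) (- b) c + F (- a) b (- c) + F a (- b) (- c)"

definition perm_sum :: "(real \<Rightarrow> real \<Rightarrow> real \<Rightarrow> real) \<Rightarrow> real \<Rightarrow> real \<Rightarrow> real \<Rightarrow> real" where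
  "perm_sum F a b c = F a b c + F a c b + F b a c + F b c a + F c a b + F c b a"

abbreviation weyl_sum :: "(real \<Rightarrow> real \<Rightarrow> real \<Rightarrow> real) \<Rightarrow> real \<Rightarrow> real \<Rightarrow> real \<Rightarrow> real" where
  "weyl_sum F \<equiv> perm_sum (sign_sum F)"

text \<open>The type \<open>gen\<close> serves here as an index set for three variables, unrelated
  to the invariants it names elsewhere.\<close>

definition poly_funs :: "(real \<Rightarrow> real \<Rightarrow> real \<Rightarrow> real) set" where
  "poly_funs = {F. \<exists>p. \<forall>a b c. F a b c = peval (\<lambda>c. c) (case_gen a b c) p}"

definition inv_funs :: "(real \<Rightarrow> real \<Rightarrow> real \<Rightarrow> real) set" where
  "inv_funs = {F. \<exists>p. \<forall>a b c. F a b c = mat_eval (inv_map p) (diag3 a b c)}"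

lemma poly_funs_mult:
  assumes "F \<in> poly_funs" "G \<in> poly_funs"
  shows "(\<lambda>a b c. F a b c * G a b c) \<in> poly_funs"
proof -
  obtain p q where "\<forall>a b c. F a b c = peval (\<lambda>c. c) (case_gen a b c) p"
      "\<forall>a b c. G a b c = peval (\<lambda>c. c) (case_gen a b c) q"
    using assms unfolding poly_funs_def by blast
  then have "\<forall>a b c. F a b c * G a b c = peval (\<lambda>c. c) (case_gen a b c) (p * q)"
    by (simp add: peval_mult[OF ring_hom_map_id])
  then show ?thesis
    unfolding poly_funs_def by blast
qed

lemma mat_eval_diag3_poly_funs: "(\<lambda>a b c. mat_eval f (R ** diag3 a b c ** S)) \<in> poly_funs"
proof -
  define y :: "coord \<Rightarrow> gen rpoly" where
    "y = (\<lambda>v. pconst (R $ row v $ 1 * S $ 1 $ col v) * pvar t2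
      + pconst (R $ row v $ 2 * S $ 2 $ col v) * pvar t3
      + pconst (R $ row v $ 3 * S $ 3 $ col v) * pvar t4)"
  have "peval (\<lambda>c. c) (case_gen a b c) (y v) = (R ** diag3 a b c ** S) $ row v $ col v" for a b c v
    by (simp add: y_def peval_simps[OF ring_hom_map_id] matrix_matrix_mult_def sum_3)
  then have "mat_eval f (R ** diag3 a b c ** S) = peval (\<lambda>c. c) (case_gen a b c) (peval pconst y f)" for a b c
    by (simp add: mat_eval_def peval_peval[OF ring_hom_map_id])
  then show ?thesis
    unfolding poly_funs_def by blast
qed

lemma inv_funs_const: "(\<lambda>_ _ _. r) \<in> inv_funs"
proof -
  have "r = mat_eval (inv_map (pconst r)) (diag3 a b c)" for a b c
    by (simp add: mat_eval_inv_map peval_pconst[OF ring_hom_map_id])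
  then show ?thesis
    unfolding inv_funs_def by blast
qed

lemma inv_funs_gen:
  "(\<lambda>a b c. a ^ 2 + b ^ 2 + c ^ 2) \<in> inv_funs"
  "(\<lambda>a b c. a * b * c) \<in> inv_funs"
  "(\<lambda>a b c. a ^ 4 + b ^ 4 + c ^ 4) \<in> inv_funs"
proof -
  have "invs (diag3 a b c) g = mat_eval (inv_map (pvar g)) (diag3 a b c)" for a b c g
    by (simp add: mat_eval_inv_map peval_pvar[OF ring_hom_map_id])
  then have "(\<lambda>a b c. invs (diag3 a b c) g) \<in> inv_funs" for g
    unfolding inv_funs_def by blast
  from this[of t2] this[of t3] this[of t4] show
    "(\<lambda>a b c. a ^ 2 + b ^ 2 + c ^ 2) \<in> inv_funs"
    "(\<lambda>a b c. a * b * c) \<in> inv_funs"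
    "(\<lambda>a b c. a ^ 4 + b ^ 4 + c ^ 4) \<in> inv_funs"
    by (simp_all only: invs_diag3)
qed

context
  fixes F G :: "real \<Rightarrow> real \<Rightarrow> real \<Rightarrow> real"
  assumes FG: "F \<in> inv_funs" "G \<in> inv_funs"
begin

lemma inv_funs_add: "(\<lambda>a b c. F a b c + G a b c) \<in> inv_funs"
  and inv_funs_mult: "(\<lambda>a b c. F a b c * G a b c) \<in> inv_funs"
proof -
  obtain p q where *: "\<forall>a b c. F a b c = mat_eval (inv_map p) (diag3 a b c)"
      "\<forall>a b c. G a b c = mat_eval (inv_map q) (diag3 a b c)"
    using FG unfolding inv_funs_def by blast
  have "\<forall>a b c. F a b c + G a b c = mat_eval (inv_map (p + q)) (diag3 a b c)"
      "\<forall>a b c. F a b c * G a b c = mat_eval (inv_map (p * q)) (diag3 a b c)"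
    by (simp_all add: * mat_eval_inv_map peval_add[OF ring_hom_map_id] peval_mult[OF ring_hom_map_id])
  then show "(\<lambda>a b c. F a b c + G a b c) \<in> inv_funs" "(\<lambda>a b c. F a b c * G a b c) \<in> inv_funs"
    unfolding inv_funs_def by blast+
qed

end

lemma inv_funs_diff:
  assumes "F \<in> inv_funs" "G \<in> inv_funs"
  shows "(\<lambda>a b c. F a b c - G a b c) \<in> inv_funs"
  using inv_funs_add[OF assms(1) inv_funs_mult[OF inv_funs_const[of "- 1"] assms(2)]] by simp

lemma inv_funs_sum:
  assumes "\<And>i. i \<in> I \<Longrightarrow> F i \<in> inv_funs"
  shows "(\<lambda>a b c. \<Sum>i\<in>I. F i a b c) \<in> inv_funs"
  using assms
  by (induction I rule: infinite_finite_induct) (simp_all add: inv_funs_const inv_funs_add)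

text \<open>The squares of a, b, c are the roots of a cubic with coefficients built from
  \<open>e1\<close>, \<open>e2\<close>, \<open>e3\<close>. Multiplying the cubic by a k-th power and
  summing over the roots is Newton's recurrence, which reaches back three steps; hence the base
  cases 0, 1 and 2.\<close>

lemma power_sum_inv_funs: "(\<lambda>a b c. (a\<^sup>2) ^ n + (b\<^sup>2) ^ n + (c\<^sup>2) ^ n) \<in> inv_funs"
proof (induction n rule: less_induct)
  case (less n)
  define P :: "nat \<Rightarrow> real \<Rightarrow> real \<Rightarrow> real \<Rightarrow> real"
    where "P n = (\<lambda>a b c. (a\<^sup>2) ^ n + (b\<^sup>2) ^ n + (c\<^sup>2) ^ n)" for n
  consider "n = 0" | "n = 1" | "n = 2" | k where "n = Suc (Suc (Suc k))"
    by (metis One_nat_def Suc_1 old.nat.exhaust)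
  then show ?case
  proof cases
    case 1
    then show ?thesis
      using inv_funs_const[of 3] by simp
  next
    case 2
    then show ?thesis
      using inv_funs_gen(1) by simp
  next
    case 3
    then show ?thesis
      using inv_funs_gen(3) by (simp flip: power_mult)
  next
    case 4
    define e1 e2 e3 :: "real \<Rightarrow> real \<Rightarrow> real \<Rightarrow> real"
      where "e1 = (\<lambda>a b c. a ^ 2 + b ^ 2 + c ^ 2)"
        and "e2 = (\<lambda>a b c. (1 / 2) * ((a ^ 2 + b ^ 2 + c ^ 2) * (a ^ 2 + b ^ 2 + c ^ 2) - (a ^ 4 + b ^ 4 + c ^ 4)))"
        and "e3 = (\<lambda>a b c. a * b * c * (a * b * c))"
    have e: "e1 \<in> inv_funs" "e2 \<in> inv_funs" "e3 \<in> inv_funs"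
      unfolding e1_def e2_def e3_def
      by (intro inv_funs_mult inv_funs_diff inv_funs_const inv_funs_gen)+
    have newton: "x ^ Suc (Suc (Suc k)) + y ^ Suc (Suc (Suc k)) + z ^ Suc (Suc (Suc k))
        = (x + y + z) * (x ^ Suc (Suc k) + y ^ Suc (Suc k) + z ^ Suc (Suc k))
        - (x * y + x * z + y * z) * (x ^ Suc k + y ^ Suc k + z ^ Suc k) + x * y * z * (x ^ k + y ^ k + z ^ k)"
      for x y z :: real
      by (simp add: algebra_simps)
    have e2': "e2 a b c = a\<^sup>2 * b\<^sup>2 + a\<^sup>2 * c\<^sup>2 + b\<^sup>2 * c\<^sup>2" for a b c
    proof -
      have "(a ^ 2 + b ^ 2 + c ^ 2) * (a ^ 2 + b ^ 2 + c ^ 2) - (a ^ 4 + b ^ 4 + c ^ 4)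
          = 2 * (a\<^sup>2 * b\<^sup>2 + a\<^sup>2 * c\<^sup>2 + b\<^sup>2 * c\<^sup>2)"
        by algebra
      then show ?thesis
        by (simp add: e2_def)
    qed
    have "P n a b c = e1 a b c * P (Suc (Suc k)) a b c - e2 a b c * P (Suc k) a b c + e3 a b c * P k a b c" for a b c
      unfolding P_def 4 newton e2' by (simp only: e1_def e3_def power2_eq_square mult_ac)
    moreover have "(\<lambda>a b c. e1 a b c * P (Suc (Suc k)) a b c - e2 a b c * P (Suc k) a b c + e3 a b c * P k a b c) \<in> inv_funs"
    proof -
      have "P m \<in> inv_funs" if "m < n" for m
        using less.IH[OF that] by (simp add: P_def)
      then have "P (Suc (Suc k)) \<in> inv_funs" "P (Suc k) \<in> inv_funs" "P k \<in> inv_funs"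
        using 4 by simp_all
      then show ?thesis
        by (intro inv_funs_add inv_funs_mult inv_funs_diff e)
    qed
    ultimately have "P n \<in> inv_funs"
      by presburger
    then show ?thesis
      by (simp only: P_def)
  qed
qed

text \<open>The product of three power sums runs over all assignments of variables to exponents,
  \<open>perm_sum\<close> over the injective ones. Moebius inversion over the partitions of a
  three-element set gives the coefficients 1, -1 and 2.\<close>

lemma perm_sum_even_monomial:
  "perm_sum (\<lambda>a b c. (a\<^sup>2) ^ i * (b\<^sup>2) ^ j * (c\<^sup>2) ^ k) \<in> inv_funs"
proof -
  define P :: "nat \<Rightarrow> real \<Rightarrow> real \<Rightarrow> real \<Rightarrow> real"
    where "P n a b c = (a\<^sup>2) ^ n + (b\<^sup>2) ^ n + (c\<^sup>2) ^ n" for n a b c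
  have P: "P n \<in> inv_funs" for n
    unfolding P_def[abs_def] by (rule power_sum_inv_funs)
  have "perm_sum (\<lambda>a b c. (a\<^sup>2) ^ i * (b\<^sup>2) ^ j * (c\<^sup>2) ^ k) a b c =
      P i a b c * P j a b c * P k a b c - P (i + j) a b c * P k a b c - P (i + k) a b c * P j a b c
      - P (j + k) a b c * P i a b c + 2 * P (i + j + k) a b c" for a b c
    unfolding perm_sum_def P_def power_add by algebra
  moreover have "(\<lambda>a b c. P i a b c * P j a b c * P k a b c - P (i + j) a b c * P k a b c - P (i + k) a b c * P j a b c
      - P (j + k) a b c * P i a b c + 2 * P (i + j + k) a b c) \<in> inv_funs"
    by (intro inv_funs_add inv_funs_mult inv_funs_diff inv_funs_const P)
  ultimately show ?thesis
    by presburger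
qed

text \<open>The four even sign changes cancel unless all exponents have the same parity. If all are
  odd, the invariant a * b * c splits off and an even monomial remains.\<close>

lemma weyl_sum_monomial: "weyl_sum (\<lambda>a b c. a ^ i * b ^ j * c ^ k) \<in> inv_funs"
proof -
  consider (even) "even i" "even j" "even k" | (odd) "odd i" "odd j" "odd k"
    | (mixed) "even i \<noteq> even j \<or> even i \<noteq> even k"
    by blast
  then show ?thesis
  proof cases
    case even
    then obtain i' j' k' where "i = 2 * i'" "j = 2 * j'" "k = 2 * k'"
      by (metis evenE)
    then have "weyl_sum (\<lambda>a b c. a ^ i * b ^ j * c ^ k)
        = (\<lambda>a b c. 4 * perm_sum (\<lambda>a b c. (a\<^sup>2) ^ i' * (b\<^sup>2) ^ j' * (c\<^sup>2) ^ k') a b c)"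
      by (simp add: fun_eq_iff sign_sum_def perm_sum_def power_mult)
    then show ?thesis
      by (simp only: inv_funs_mult inv_funs_const perm_sum_even_monomial)
  next
    case odd
    then obtain i' j' k' where "i = 2 * i' + 1" "j = 2 * j' + 1" "k = 2 * k' + 1"
      by (metis oddE)
    then have pow: "a ^ i = a * (a\<^sup>2) ^ i'" "a ^ j = a * (a\<^sup>2) ^ j'" "a ^ k = a * (a\<^sup>2) ^ k'" for a :: real
      by (simp_all add: power_mult)
    have "sign_sum (\<lambda>a b c. a ^ i * b ^ j * c ^ k)
        = (\<lambda>a b c. 4 * (a * b * c) * ((a\<^sup>2) ^ i' * (b\<^sup>2) ^ j' * (c\<^sup>2) ^ k'))"
      by (simp add: fun_eq_iff sign_sum_def pow)
    then have "weyl_sum (\<lambda>a b c. a ^ i * b ^ j * c ^ k)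
        = (\<lambda>a b c. (4 * (a * b * c)) * perm_sum (\<lambda>a b c. (a\<^sup>2) ^ i' * (b\<^sup>2) ^ j' * (c\<^sup>2) ^ k') a b c)"
      by (simp add: fun_eq_iff perm_sum_def distrib_left mult_ac)
    then show ?thesis
      by (simp only: inv_funs_mult inv_funs_const inv_funs_gen perm_sum_even_monomial)
  next
    case mixed
    then have "sign_sum (\<lambda>a b c. a ^ i * b ^ j * c ^ k) = (\<lambda>_ _ _. 0)"
      by (auto simp: fun_eq_iff sign_sum_def uminus_power_if)
    then show ?thesis
      using inv_funs_const[of 0] by (simp add: perm_sum_def[abs_def])
  qed
qed

lemma weyl_sum_inv_funs:
  assumes "F \<in> poly_funs"
  shows "weyl_sum F \<in> inv_funs"
proof -
  obtain p where p: "\<And>a b c. F a b c = peval (\<lambda>c. c) (case_gen a b c) p"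
    using assms unfolding poly_funs_def by blast
  define mono where "mono m a b c = a ^ Poly_Mapping.lookup m t2 * b ^ Poly_Mapping.lookup m t3 * c ^ Poly_Mapping.lookup m t4"
    for m and a b c :: real
  have "meval (case_gen a b c) m = mono m a b c" for m and a b c :: real
  proof -
    have "Poly_Mapping.keys m \<subseteq> {t2, t3, t4}"
      using gen.exhaust by blast
    then show ?thesis
      using meval_superset[of "{t2, t3, t4}" m "case_gen a b c"] by (simp add: mono_def mult.assoc)
  qed
  then have "F a b c = (\<Sum>m\<in>Poly_Mapping.keys p. Poly_Mapping.lookup p m * mono m a b c)" for a b c
    by (simp add: p peval_meval)
  then have "weyl_sum F = (\<lambda>a b c. \<Sum>m\<in>Poly_Mapping.keys p. Poly_Mapping.lookup p m * weyl_sum (mono m) a b c)"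
    by (simp add: fun_eq_iff sign_sum_def perm_sum_def sum.distrib sum_distrib_left distrib_left)
  moreover have "weyl_sum (mono m) \<in> inv_funs" for m
    unfolding mono_def[abs_def] by (rule weyl_sum_monomial)
  then have "(\<lambda>a b c. \<Sum>m\<in>Poly_Mapping.keys p. Poly_Mapping.lookup p m * weyl_sum (mono m) a b c) \<in> inv_funs"
    by (intro inv_funs_sum inv_funs_mult inv_funs_const)
  ultimately show ?thesis
    by simp
qed

text \<open>All 24 arguments lie in the orbit of \<open>diag3 x y z\<close>, so a ratio that is
  constant on the orbit leaves the sum. \<open>G\<close> is constantly 1 for polynomials and a
  square for fractions.\<close>

lemma weyl_sum_orbit:
  assumes "\<And>a b c. orbit_equiv (diag3 x y z) (diag3 a b c) \<Longrightarrow> F a b c = r * G a b c"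
  shows "weyl_sum F x y z = r * weyl_sum G x y z"
proof -
  have perm: "orbit_equiv (diag3 a b c) (diag3 c a b)" "orbit_equiv (diag3 a b c) (diag3 b c a)" for a b c :: real
    using orbit_equiv_diag3 orbit_equiv_trans by metis+
  have "sign_sum F a b c = r * sign_sum G a b c" if "orbit_equiv (diag3 x y z) (diag3 a b c)" for a b c
  proof -
    have "orbit_equiv (diag3 x y z) (diag3 (- a) (- b) c)" "orbit_equiv (diag3 x y z) (diag3 (- a) b (- c))"
        "orbit_equiv (diag3 x y z) (diag3 a (- b) (- c))"
      using orbit_equiv_trans[OF that] orbit_equiv_diag3 by blast+
    then show ?thesis
      using that by (simp add: sign_sum_def assms distrib_left)
  qed
  moreover have "orbit_equiv (diag3 x y z) (diag3 x y z)"
    using orbit_equivI[OF rotations_one rotations_one, of "diag3 x y z"] by simp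
  ultimately show ?thesis
    by (simp add: perm_sum_def orbit_equiv_diag3 perm distrib_left)
qed

section \<open>Every polynomial invariant is reached\<close>

lemma invariants_eqI:
  assumes "f \<in> invariant_ring" "g \<in> invariant_ring"
    "\<And>a b c. mat_eval f (diag3 a b c) = mat_eval g (diag3 a b c)"
  shows "f = g"
  using assms singular_value_decomposition
  by (intro mat_eval_eq_imp_eq) (metis invariant_ring_iff)

lemma range_inv_map: "range inv_map = invariant_ring"
proof
  show "range inv_map \<subseteq> invariant_ring"
    using inv_map_invariant by blast
next
  show "invariant_ring \<subseteq> range inv_map"
  proof
    fix f
    assume f: "f \<in> invariant_ring"
    let ?F = "\<lambda>a b c. mat_eval f (diag3 a b c)"
    have "?F \<in> poly_funs"
      using mat_eval_diag3_poly_funs[of f "mat 1" "mat 1"] by simp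
    then obtain p where p: "\<And>a b c. weyl_sum ?F a b c = mat_eval (inv_map p) (diag3 a b c)"
      using weyl_sum_inv_funs unfolding inv_funs_def by blast
    \<comment> \<open>Here the ratio is the value of \<open>f\<close> on the orbit, and the sum of
      24 ones is divided out afterwards.\<close>
    have "weyl_sum ?F a b c = ?F a b c * weyl_sum (\<lambda>_ _ _. 1) a b c" for a b c
      using f by (intro weyl_sum_orbit) (simp add: invariant_ring_iff)
    moreover have "weyl_sum (\<lambda>_ _ _. 1) a b c = 24" for a b c
      by (simp add: perm_sum_def sign_sum_def)
    ultimately have "mat_eval (inv_map p) (diag3 a b c) = ?F a b c * 24" for a b c
      by (simp only: p)
    then have "?F a b c = mat_eval (inv_map (pconst (1 / 24) * p)) (diag3 a b c)" for a b c
      by (simp add: mat_eval_inv_map peval_simps[OF ring_hom_map_id])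
    then have "f = inv_map (pconst (1 / 24) * p)"
      by (intro invariants_eqI f inv_map_invariant)
    then show "f \<in> range inv_map"
      by blast
  qed
qed


section \<open>Rational invariants\<close>

lemma invariant_field_eqD:
  assumes f: "Fract P Q \<in> invariant_field" and "orbit_equiv C D"
    and nz: "mat_eval Q C \<noteq> 0" "mat_eval Q D \<noteq> 0"
  shows "mat_eval P D / mat_eval Q D = mat_eval P C / mat_eval Q C"
proof -
  obtain U W where UW: "U \<in> unitary_group" "W \<in> unitary_group" and D: "D = corr_mat (act U W (state_of C))"
    using orbit_equiv_imp_act[OF assms(2)] by blast
  have "rat_value_at (Fract P Q) (act U W (state_of C)) (mat_eval P D / mat_eval Q D)"
    unfolding rat_value_at_def value_at_mat_eval D[symmetric] using nz by blast
  moreover have "rat_value_at (Fract P Q) (state_of C) (mat_eval P C / mat_eval Q C)"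
    unfolding rat_value_at_def value_at_mat_eval corr_mat_state_of using nz by blast
  ultimately show ?thesis
    using f UW state_of_lmm[of C] unfolding invariant_field_def by blast
qed

definition translate :: "real^3^3 \<Rightarrow> real^3^3 \<Rightarrow> coord rpoly \<Rightarrow> coord rpoly" where
  "translate R S = peval pconst
    (\<lambda>v. \<Sum>l\<in>UNIV. \<Sum>k\<in>UNIV. pconst (R $ row v $ k * S $ l $ col v) * pvar (Corr k l))"

lemma mat_eval_translate: "mat_eval (translate R S f) C = mat_eval f (R ** C ** S)"
  by (simp add: translate_def mat_eval_def peval_peval[OF ring_hom_map_id] peval_simps[OF ring_hom_map_id]
      matrix_matrix_mult_def sum_distrib_left sum_distrib_right mult_ac)

text \<open>The two values may come from different representatives of \<open>f\<close>, at points
  where \<open>q\<close> vanishes, so p / q cannot be evaluated there. Instead the equality of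
  values is stated as a polynomial identity, proved after multiplication by \<open>q\<close>, freed
  from \<open>q\<close> in the integral domain, and only then evaluated.\<close>

lemma fraction_field_subset_invariant_field: "fraction_field invariant_ring \<subseteq> invariant_field"
proof
  fix f
  assume "f \<in> fraction_field invariant_ring"
  then obtain p q where f: "f = Fract p q" and pq: "p \<in> invariant_ring" "q \<in> invariant_ring" "q \<noteq> 0"
    unfolding fraction_field_def by blast
  have "c = d" if UW: "U \<in> unitary_group" "W \<in> unitary_group"
    and c: "rat_value_at f (act U W \<rho>) c" and d: "rat_value_at f \<rho> d" for U W \<rho> c d
  proof -
    let ?R = "rot_of U" and ?S = "transpose (rot_of W)"
    let ?C = "corr_mat \<rho>"
    have act: "corr_mat (act U W \<rho>) = ?R ** ?C ** ?S"
      by (rule corr_mat_act[OF UW])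
    have orb: "orbit_equiv C (?R ** C ** ?S)" for C
      using UW by (intro orbit_equivI rotations_transpose) (auto simp: rotations_def)
    obtain P' Q' where 1: "f = Fract P' Q'" "mat_eval Q' (?R ** ?C ** ?S) \<noteq> 0"
        "c = mat_eval P' (?R ** ?C ** ?S) / mat_eval Q' (?R ** ?C ** ?S)"
      using c unfolding rat_value_at_def value_at_mat_eval act by blast
    obtain P Q where 2: "f = Fract P Q" "mat_eval Q ?C \<noteq> 0" "d = mat_eval P ?C / mat_eval Q ?C"
      using d unfolding rat_value_at_def value_at_mat_eval by blast
    have "Q' \<noteq> 0" "Q \<noteq> 0"
      using 1(2) 2(2) by (auto simp: mat_eval_0)
    then have "p * Q' = P' * q" "p * Q = P * q"
      using eq_fract(1)[OF pq(3), of _ p] 1(1) 2(1) unfolding f by metis+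
    then have eq: "mat_eval p C * mat_eval Q' C = mat_eval P' C * mat_eval q C"
        "mat_eval p C * mat_eval Q C = mat_eval P C * mat_eval q C" for C
      by (simp_all add: mat_eval_def flip: peval_mult[OF ring_hom_map_id])
    have "q * (translate ?R ?S P' * Q - P * translate ?R ?S Q') = 0"
    proof (rule mat_eval_eq_imp_eq)
      fix C
      let ?D = "?R ** C ** ?S"
      have inv: "mat_eval p ?D = mat_eval p C" "mat_eval q ?D = mat_eval q C"
        using pq orb unfolding invariant_ring_iff by blast+
      have "mat_eval q C * (mat_eval P' ?D * mat_eval Q C) = mat_eval P' ?D * mat_eval q ?D * mat_eval Q C"
        by (simp add: inv)
      also have "\<dots> = mat_eval p C * mat_eval Q C * mat_eval Q' ?D"
        by (simp only: eq(1)[symmetric]) (simp add: inv)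
      also have "\<dots> = mat_eval q C * (mat_eval P C * mat_eval Q' ?D)"
        by (simp add: eq(2))
      finally show "mat_eval (q * (translate ?R ?S P' * Q - P * translate ?R ?S Q')) C = mat_eval 0 C"
        unfolding mat_eval_def[of _ C] hom_simps[OF ring_hom_map_peval[OF ring_hom_map_id]]
        by (simp flip: mat_eval_def add: mat_eval_translate right_diff_distrib)
    qed
    then have "translate ?R ?S P' * Q = P * translate ?R ?S Q'"
      using pq(3) by simp
    then have "mat_eval P' (?R ** ?C ** ?S) * mat_eval Q ?C = mat_eval P ?C * mat_eval Q' (?R ** ?C ** ?S)"
      unfolding mat_eval_translate[symmetric] by (simp add: mat_eval_def flip: peval_mult[OF ring_hom_map_id])
    then show "c = d"
      using 1(2) 2(2) unfolding 1(3) 2(3) by (simp add: frac_eq_eq)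
  qed
  then show "f \<in> invariant_field"
    unfolding invariant_field_def by blast
qed

text \<open>Averaging \<open>P * Q\<close> and \<open>Q * Q\<close> over the Weyl group yields a numerator and a denominator
  that are invariant polynomials; a sum of squares vanishes only where all its terms do.\<close>

lemma invariant_field_subset_fraction_field: "invariant_field \<subseteq> fraction_field invariant_ring"
proof
  fix f
  assume f: "f \<in> invariant_field"
  obtain P Q where PQ: "f = Fract P Q" "Q \<noteq> 0"
    by (cases f) auto
  have "\<exists>C. mat_eval Q C \<noteq> 0"
    using PQ(2) mat_eval_eq_imp_eq[of Q 0] by (auto simp: mat_eval_0)
  \<comment> \<open>\<open>Q\<close> may vanish on all diagonal matrices. Diagonalising a point
    where it does not vanish gives a translated slice on which it is not identically zero.\<close>
  then obtain R S x y z where RS: "R \<in> rotations" "S \<in> rotations"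
    and nz: "mat_eval Q (R ** diag3 x y z ** S) \<noteq> 0"
    using singular_value_decomposition unfolding orbit_equiv_def by metis
  define F where "F a b c = mat_eval P (R ** diag3 a b c ** S)" for a b c
  define G where "G a b c = mat_eval Q (R ** diag3 a b c ** S)" for a b c
  have poly: "F \<in> poly_funs" "G \<in> poly_funs"
    unfolding F_def[abs_def] G_def[abs_def] by (rule mat_eval_diag3_poly_funs)+
  obtain n where n: "\<And>a b c. weyl_sum (\<lambda>a b c. F a b c * G a b c) a b c = mat_eval (inv_map n) (diag3 a b c)"
    using weyl_sum_inv_funs[OF poly_funs_mult[OF poly]] unfolding inv_funs_def by blast
  obtain d where d: "\<And>a b c. weyl_sum (\<lambda>a b c. G a b c * G a b c) a b c = mat_eval (inv_map d) (diag3 a b c)"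
    using weyl_sum_inv_funs[OF poly_funs_mult[OF poly(2) poly(2)]] unfolding inv_funs_def by blast
  have "0 < G x y z * G x y z"
    using nz unfolding G_def by (metis not_real_square_gt_zero)
  then have "0 < weyl_sum (\<lambda>a b c. G a b c * G a b c) x y z"
    unfolding perm_sum_def sign_sum_def by (intro add_pos_nonneg add_nonneg_nonneg zero_le_square)
  then have d0: "inv_map d \<noteq> 0"
    unfolding d by (auto simp: mat_eval_0)
  \<comment> \<open>The outer factor \<open>Q\<close> makes the identity trivial where
    \<open>Q\<close> vanishes and is cancelled at the end.\<close>
  have "Q * (P * inv_map d - Q * inv_map n) = 0"
  proof (rule mat_eval_eq_imp_eq)
    fix C
    have "mat_eval Q C * (mat_eval P C * mat_eval (inv_map d) C - mat_eval Q C * mat_eval (inv_map n) C) = 0"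
    proof (cases "mat_eval Q C = 0")
      case False
      define r where "r = mat_eval P C / mat_eval Q C"
      obtain a b c where C: "orbit_equiv (diag3 a b c) C"
        using singular_value_decomposition by blast
      \<comment> \<open>By invariance the quotient is \<open>r\<close> wherever it is defined on
        this orbit; where \<open>G\<close> is zero, the additional factor \<open>G\<close> makes
        both sides zero.\<close>
      have "F a' b' c' * G a' b' c' = r * (G a' b' c' * G a' b' c')"
        if "orbit_equiv (diag3 a b c) (diag3 a' b' c')" for a' b' c'
      proof (cases "G a' b' c' = 0")
        case nonzero: False
        have "orbit_equiv C (R ** diag3 a' b' c' ** S)"
          using orbit_equiv_trans[OF orbit_equiv_sym[OF C] orbit_equiv_trans[OF that orbit_equivI[OF RS]]] .
        then have "F a' b' c' / G a' b' c' = r"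
          using invariant_field_eqD[of P Q C "R ** diag3 a' b' c' ** S"] f PQ False nonzero
          by (simp add: F_def G_def r_def)
        then show ?thesis
          using nonzero by (simp add: field_simps)
      qed simp
      then have "mat_eval (inv_map n) (diag3 a b c) = r * mat_eval (inv_map d) (diag3 a b c)"
        unfolding n[symmetric] d[symmetric] by (rule weyl_sum_orbit)
      then have "mat_eval (inv_map n) C = r * mat_eval (inv_map d) C"
        by (simp add: mat_eval_inv_map invs_orbit_equiv[OF C])
      then show ?thesis
        using False by (simp add: r_def)
    qed simp
    then show "mat_eval (Q * (P * inv_map d - Q * inv_map n)) C = mat_eval 0 C"
      unfolding mat_eval_def hom_simps[OF ring_hom_map_peval[OF ring_hom_map_id]] .
  qed
  then have "P * inv_map d = inv_map n * Q"
    using PQ(2) by (simp add: mult.commute)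
  then have "f = Fract (inv_map n) (inv_map d)"
    using PQ d0 by (simp add: eq_fract)
  then show "f \<in> fraction_field invariant_ring"
    unfolding fraction_field_def using d0 inv_map_invariant by blast
qed

lemma invariant_field_eq: "invariant_field = fraction_field invariant_ring"
  using invariant_field_subset_fraction_field fraction_field_subset_invariant_field by blast


section \<open>Pure transcendence\<close>

definition gen_rat :: "gen \<Rightarrow> coord rrat" where
  "gen_rat g = Fract (inv_map (pvar g)) 1"

lemma peval_pconst_pvar: "peval pconst pvar p = p"
  by (rule peval_eq_imp_eq) (simp add: peval_peval[OF ring_hom_map_id] peval_pvar[OF ring_hom_map_id])

text \<open>A polynomial is its own evaluation at the indeterminates, so the homomorphism in
  question is determined by its values on constants and indeterminates.\<close>

lemma peval_gen_rat: "peval rconst gen_rat p = Fract (inv_map p) 1"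
proof -
  have "ring_hom_map (\<lambda>p. Fract (inv_map p) 1)"
    by (rule ring_hom_map_comp[OF ring_hom_map_Fract ring_hom_map_inv_map])
  from hom_peval[OF this, of pconst pvar p] show ?thesis
    by (simp add: peval_pconst_pvar inv_map_pconst gen_rat_def[abs_def] rconst_def[abs_def])
qed

lemma inj_pvar: "inj (pvar :: 'v \<Rightarrow> 'v rpoly)"
proof (rule injI)
  fix v w :: 'v
  assume "(pvar v :: 'v rpoly) = pvar w"
  then have "peval (\<lambda>c. c) (\<lambda>u. if u = v then 1 else 0 :: real) (pvar v)
      = peval (\<lambda>c. c) (\<lambda>u. if u = v then 1 else 0) (pvar w)"
    by simp
  then show "v = w"
    by (simp add: peval_pvar[OF ring_hom_map_id] split: if_splits)
qed

lemma inj_gen_rat: "inj gen_rat"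
  by (rule injI) (auto simp: gen_rat_def eq_fract dest!: injD[OF inj_inv_map] injD[OF inj_pvar])

section \<open>Subfields and the field generated by the invariants\<close>

context
  fixes F :: "'k::field set"
  assumes F: "is_subfield F"
begin

lemma subfield_sum: "(\<And>i. i \<in> I \<Longrightarrow> g i \<in> F) \<Longrightarrow> sum g I \<in> F"
  using F by (induction I rule: infinite_finite_induct) (auto simp: is_subfield_def)

lemma subfield_prod: "(\<And>i. i \<in> I \<Longrightarrow> g i \<in> F) \<Longrightarrow> prod g I \<in> F"
  using F by (induction I rule: infinite_finite_induct) (auto simp: is_subfield_def)

lemma subfield_power: "a \<in> F \<Longrightarrow> a ^ n \<in> F"
  using F by (induction n) (auto simp: is_subfield_def)

lemma subfield_mult: "a \<in> F \<Longrightarrow> b \<in> F \<Longrightarrow> a * b \<in> F"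
  using F by (auto simp: is_subfield_def)

lemma subfield_peval:
  assumes "range \<iota> \<subseteq> F" "\<And>v. x v \<in> F"
  shows "peval \<iota> x p \<in> F"
  unfolding peval_def using assms
  by (intro subfield_sum subfield_mult subfield_prod subfield_power) auto

end

lemma fraction_field_invariant_ring:
  "fraction_field invariant_ring = {Fract (inv_map p) (inv_map q) | p q. inv_map q \<noteq> 0}"
  unfolding fraction_field_def range_inv_map[symmetric] by blast

lemma subfield_invariant_field: "is_subfield (fraction_field invariant_ring)"
proof -
  let ?F = "fraction_field invariant_ring"
  note hom = hom_simps[OF ring_hom_map_inv_map]
  have I: "Fract (inv_map p) (inv_map q) \<in> ?F" if "inv_map q \<noteq> 0" for p q
    using that unfolding fraction_field_invariant_ring by blast
  have 0: "0 \<in> ?F" and 1: "1 \<in> ?F"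
    using I[of 1 0] I[of 1 1] by (simp_all add: hom Zero_fract_def One_fract_def)
  have "a + b \<in> ?F \<and> a * b \<in> ?F" if ab: "a \<in> ?F" "b \<in> ?F" for a b
  proof -
    obtain p q where a: "a = Fract (inv_map p) (inv_map q)" "inv_map q \<noteq> 0"
      using ab(1) unfolding fraction_field_invariant_ring by blast
    obtain r s where b: "b = Fract (inv_map r) (inv_map s)" "inv_map s \<noteq> 0"
      using ab(2) unfolding fraction_field_invariant_ring by blast
    note * = a b
    have "a + b = Fract (inv_map (p * s + r * q)) (inv_map (q * s))"
        "a * b = Fract (inv_map (p * r)) (inv_map (q * s))"
      using * by (simp_all add: hom)
    moreover have "inv_map (q * s) \<noteq> 0"
      using * by (simp add: hom)
    ultimately show ?thesis
      using I by metis
  qed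
  moreover have "- a \<in> ?F \<and> inverse a \<in> ?F" if a: "a \<in> ?F" for a
  proof -
    obtain p q where *: "a = Fract (inv_map p) (inv_map q)" "inv_map q \<noteq> 0"
      using a unfolding fraction_field_invariant_ring by blast
    have "- a = Fract (inv_map (- p)) (inv_map q)"
      using * by (simp add: hom)
    then have "- a \<in> ?F"
      using I *(2) by metis
    moreover have "inverse a \<in> ?F"
    proof (cases "inv_map p = 0")
      case True
      then show ?thesis
        using * 0 by (simp add: Zero_fract_def eq_fract)
    next
      case False
      then show ?thesis
        using I[OF False, of q] * by simp
    qed
    ultimately show ?thesis
      by blast
  qed
  ultimately show ?thesis
    using 0 1 by (simp add: is_subfield_def)
qed

lemma generated_field_gen_rat: "generated_field (range gen_rat) = fraction_field invariant_ring"
proof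
  have one: "inv_map 1 = 1"
    by (rule hom_one[OF ring_hom_map_inv_map])
  have I: "Fract (inv_map p) 1 \<in> fraction_field invariant_ring" for p
    unfolding fraction_field_invariant_ring using one by (metis (mono_tags, lifting) mem_Collect_eq zero_neq_one)
  have "range rconst \<subseteq> fraction_field invariant_ring"
    using I[of "pconst _"] by (auto simp: rconst_def inv_map_pconst)
  moreover have "range gen_rat \<subseteq> fraction_field invariant_ring"
    using I by (auto simp: gen_rat_def)
  ultimately show "generated_field (range gen_rat) \<subseteq> fraction_field invariant_ring"
    unfolding generated_field_def using subfield_invariant_field by blast
next
  show "fraction_field invariant_ring \<subseteq> generated_field (range gen_rat)"
  proof
    fix f
    assume "f \<in> fraction_field invariant_ring"
    then obtain p q where f: "f = Fract (inv_map p) (inv_map q)" "inv_map q \<noteq> 0"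
      unfolding fraction_field_invariant_ring by blast
    then have f': "f = Fract (inv_map p) 1 * inverse (Fract (inv_map q) 1)"
      by simp
    have "f \<in> F" if F: "is_subfield F" and sub: "range rconst \<subseteq> F" "range gen_rat \<subseteq> F" for F
    proof -
      have "Fract (inv_map p) 1 \<in> F" for p
        unfolding peval_gen_rat[symmetric] using sub by (intro subfield_peval[OF F]) auto
      then show ?thesis
        using F unfolding f' is_subfield_def by blast
    qed
    then show "f \<in> generated_field (range gen_rat)"
      unfolding generated_field_def by blast
  qed
qed

text \<open>A relation has its variables named by the generators themselves. Renaming them through
  the inverse of \<open>gen_rat\<close> turns it into an element of the kernel of
  \<open>inv_map\<close>; since all its variables lie in the range, the renaming can be undone and
  loses nothing.\<close>

lemma algebraically_independent_gen_rat: "algebraically_independent (range gen_rat)"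
  unfolding algebraically_independent_def
proof (intro allI impI)
  fix P :: "coord rrat rpoly"
  assume vars: "pvars P \<subseteq> range gen_rat" and P0: "peval rconst (\<lambda>b. b) P = 0"
  define P' where "P' = peval pconst (\<lambda>b. pvar (inv gen_rat b)) P"
  have "Fract (inv_map P') 1 = peval rconst (\<lambda>b. gen_rat (inv gen_rat b)) P"
    unfolding peval_gen_rat[symmetric] P'_def
    by (simp add: peval_peval[OF ring_hom_map_rconst] peval_pvar[OF ring_hom_map_rconst])
  also have "\<dots> = peval rconst (\<lambda>b. b) P"
    using vars by (intro peval_cong_pvars) (auto simp: f_inv_into_f)
  finally have "inv_map P' = 0"
    using P0 by (simp add: Zero_fract_def eq_fract)
  then have P'0: "P' = 0"
    by (rule inv_map_eq_0)
  show "P = 0"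
  proof (rule peval_zero_imp_zero)
    fix x :: "coord rrat \<Rightarrow> real"
    have "peval (\<lambda>c. c) x P = peval (\<lambda>c. c) (\<lambda>b. x (gen_rat (inv gen_rat b))) P"
      using vars by (intro peval_cong_pvars) (auto simp: f_inv_into_f)
    also have "\<dots> = peval (\<lambda>c. c) (\<lambda>g. x (gen_rat g)) P'"
      unfolding P'_def by (simp add: peval_peval[OF ring_hom_map_id] peval_pvar[OF ring_hom_map_id])
    also have "\<dots> = 0"
      by (simp add: P'0 peval_def)
    finally show "peval (\<lambda>c. c) x P = 0" .
  qed
qed

lemma algebraic_over_member:
  assumes "is_subfield F" "a \<in> F"
  shows "algebraic_over F a"
proof -
  have "coeff [:- a, 1:] i \<in> F" for i
    using assms by (auto simp: is_subfield_def coeff_pCons split: nat.split)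
  then show ?thesis
    unfolding algebraic_over_def by (intro exI[of _ "[:- a, 1:]"]) simp
qed

text \<open>The generators already generate the whole field, so each element is algebraic as the
  root of a linear polynomial.\<close>

lemma transcendence_basis_gen_rat: "transcendence_basis invariant_field (range gen_rat)"
proof -
  have "range gen_rat \<subseteq> generated_field (range gen_rat)"
    unfolding generated_field_def by blast
  then show ?thesis
    unfolding transcendence_basis_def invariant_field_eq generated_field_gen_rat
    using algebraically_independent_gen_rat algebraic_over_member[OF subfield_invariant_field] by blast
qed

lemma graded_algebra_iso_inv_map: "graded_algebra_iso gen_degree (\<lambda>_. 1) invariant_ring inv_map"
  unfolding graded_algebra_iso_def
proof (intro conjI allI)
  show "bij_betw inv_map UNIV invariant_ring"
    by (simp add: bij_betw_def inj_inv_map range_inv_map)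
  show "inv_map ` {p. homogeneous gen_degree d p} = {f \<in> invariant_ring. homogeneous (\<lambda>_. 1) d f}" for d
    unfolding range_inv_map[symmetric] using homogeneous_inv_map_iff by blast
qed (simp_all add: hom_simps[OF ring_hom_map_inv_map] inv_map_pconst)

theorem theorem1:
  "\<exists>\<phi> :: gen rpoly \<Rightarrow> coord rpoly.
     graded_algebra_iso gen_degree (\<lambda>_. 1) invariant_ring \<phi> \<and>
     invariant_field = fraction_field invariant_ring \<and>
     has_transcendence_degree invariant_field 3 \<and>
     (let B = {Fract (\<phi> (pvar t2)) 1, Fract (\<phi> (pvar t3)) 1, Fract (\<phi> (pvar t4)) 1} in
        card B = 3 \<and> purely_transcendental invariant_field B)"
proof -
  have "UNIV = {t2, t3, t4}"
    using gen.exhaust by blast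
  then have B: "range gen_rat = {Fract (inv_map (pvar t2)) 1, Fract (inv_map (pvar t3)) 1, Fract (inv_map (pvar t4)) 1}"
    unfolding \<open>UNIV = {t2, t3, t4}\<close> by (simp add: gen_rat_def)
  have card: "card (range gen_rat) = 3"
    unfolding \<open>UNIV = {t2, t3, t4}\<close> by (simp add: inj_eq[OF inj_gen_rat])
  then have "has_transcendence_degree invariant_field 3"
    unfolding has_transcendence_degree_def
    \<comment> \<open>Infinite sets have cardinality 0 by convention, so cardinality 3 already
      implies finiteness.\<close>
    using transcendence_basis_gen_rat card.infinite by (metis zero_neq_numeral)
  moreover have "purely_transcendental invariant_field (range gen_rat)"
    by (simp add: purely_transcendental_def algebraically_independent_gen_rat generated_field_gen_rat invariant_field_eq)
  ultimately show ?thesis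
    using graded_algebra_iso_inv_map invariant_field_eq card unfolding B Let_def
    by (intro exI[of _ inv_map]) simp
qed

end
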